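(* Let $m\ge 1$ and $n\ge 0$ be integers with $m\leq n+2$, let $k=\lfloor n/2\rfloor$ and let $$\underline{s}(m,n)=\begin{cases}(m+1)k-\frac{(m-2)(m+1)}{2} & \text{if } n \text{ is even},\\ (m+1)k-\frac{(m-3)(m+1)}{2} & \text{if } m \text{ and } n \text{ are odd},\\ (m+1)k-\frac{(m-3)(m+1)+1}{2} & \text{if } m \text{ is even and } n \text{ is odd.}\end{cases}$$ Then $T(m,n;1,2;s)$ is true for any integer $0\le s\leq \underline{s}(m,n)$.
   Context: Let $V$, $W$ be complex vector spaces of dimensions $m+1$, $n+1$. Let $X_{m,n}\subset\mathbb{P}(V\otimes S_2(W))$ be the Segre-Veronese variety $\mathbb{P}(V)\times\mathbb{P}(W)$ embedded by $\mathcal{O}(1,2)$, i.e. the set of points $[u\otimes v^2]$ with $u\in V\setminus\{0\}$, $v\in W\setminus\{0\}$. For $p=[u\otimes v^2]\in X_{m,n}$ let $T_p(X_{m,n})=V\otimes v^2+u\otimes vW\subset V\otimes S_2(W)$, the affine cone over the tangent space at $p$. The statement "$T(m,n;1,2;s)$ is true" means that for general points $p_1,\dots,p_s\in X_{m,n}$ the subspace $\sum_{i=1}^sT_{p_i}(X_{m,n})$ of $V\otimes S_2(W)$ has dimension $\min\{s(m+n+1),(m+1)\binom{n+2}{2}\}$. Equivalently (for $s\geq 1$, by Terracini's lemma), the $s$-th secant variety $\sigma_s(X_{m,n})$ (Zariski closure of the union of the linear spans of $s$-tuples of points of $X_{m,n}$) has the expected dimension $\min\{s(m+n+1),(m+1)\binom{n+2}{2}\}-1$.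 *)

theory Defs
  imports Complex_Main "HOL-Library.FuncSet" "HOL-Library.Function_Algebras"
begin

text \<open>Vectors and tensors are complex-valued functions on an index type (natural numbers, pairs,
  triples), with pointwise operations.\<close>

definition cscale :: "complex \<Rightarrow> ('i \<Rightarrow> complex) \<Rightarrow> 'i \<Rightarrow> complex" where
  "cscale c x = (\<lambda>i. c * x i)"

global_interpretation cfun: vector_space cscale
  by unfold_locales (auto simp: cscale_def fun_eq_iff algebra_simps)

text \<open>\<^term>\<open>cspace d\<close> is $\mathbb{C}^d$. Below, $V$ is \<open>cspace (m + 1)\<close> and $W$ is \<open>cspace (n + 1)\<close>.\<close>

definition cspace :: "nat \<Rightarrow> (nat \<Rightarrow> complex) set" where
  "cspace d = {x. \<forall>i\<ge>d. x i = 0}"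

text \<open>The symmetric square of $\mathbb{C}^d$, realised as the symmetric $d \times d$ matrices, and
  the product $vw$ of two vectors in it.\<close>

definition Sym2 :: "nat \<Rightarrow> (nat \<times> nat \<Rightarrow> complex) set" where
  "Sym2 d = {q. \<forall>j k. q (j, k) = q (k, j) \<and> (d \<le> j \<longrightarrow> q (j, k) = 0)}"

definition symprod :: "(nat \<Rightarrow> complex) \<Rightarrow> (nat \<Rightarrow> complex) \<Rightarrow> nat \<times> nat \<Rightarrow> complex" where
  "symprod v w = (\<lambda>(j, k). (v j * w k + w j * v k) / 2)"

definition tensor :: "(nat \<Rightarrow> complex) \<Rightarrow> (nat \<times> nat \<Rightarrow> complex) \<Rightarrow> nat \<times> nat \<times> nat \<Rightarrow> complex" where
  "tensor u q = (\<lambda>(i, jk). u i * q jk)"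

type_synonym tens = "nat \<times> nat \<times> nat \<Rightarrow> complex"

text \<open>The space $V \otimes S_2(W)$.\<close>

definition VS2W :: "nat \<Rightarrow> nat \<Rightarrow> tens set" where
  "VS2W m n = cfun.span {tensor u q | u q. u \<in> cspace (m + 1) \<and> q \<in> Sym2 (n + 1)}"

text \<open>A point of projective space is a one-dimensional subspace.\<close>

definition proj_pt :: "tens \<Rightarrow> tens set" where
  "proj_pt t = cfun.span {t}"

definition proj_space :: "nat \<Rightarrow> nat \<Rightarrow> tens set set" where
  "proj_space m n = proj_pt ` (VS2W m n - {0})"

definition segre_veronese :: "nat \<Rightarrow> nat \<Rightarrow> tens set set" where
  "segre_veronese m n =
     {proj_pt (tensor u (symprod v v)) | u v. u \<in> cspace (m + 1) - {0} \<and> v \<in> cspace (n + 1) - {0}}"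

text \<open>The affine cone $T_p = V \otimes v^2 + u \otimes vW$ over the tangent space at
  $p = [u \otimes v^2]$. Since $p$ determines $u$ and $v$ up to nonzero scalars, and scaling them does
  not change $V \otimes v^2 + u \otimes vW$, letting $u$ and $v$ range over all possible choices
  gives the same set as fixing one.\<close>

definition tangent_cone :: "nat \<Rightarrow> nat \<Rightarrow> tens set \<Rightarrow> tens set" where
  "tangent_cone m n p =
     {tensor x (symprod v v) + tensor u (symprod v w) | x u v w.
        x \<in> cspace (m + 1) \<and> w \<in> cspace (n + 1) \<and>
        u \<in> cspace (m + 1) - {0} \<and> v \<in> cspace (n + 1) - {0} \<and>
        p = proj_pt (tensor u (symprod v v))}"

text \<open>Polynomial functions in the coordinates of an \<open>s\<close>-tuple of tensors.\<close>

inductive poly_fun :: "nat \<Rightarrow> ((nat \<Rightarrow> tens) \<Rightarrow> complex) \<Rightarrow> bool" for s where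
  const: "poly_fun s (\<lambda>t. c)"
| coord: "i < s \<Longrightarrow> poly_fun s (\<lambda>t. t i a)"
| add: "poly_fun s F \<Longrightarrow> poly_fun s G \<Longrightarrow> poly_fun s (\<lambda>t. F t + G t)"
| mult: "poly_fun s F \<Longrightarrow> poly_fun s G \<Longrightarrow> poly_fun s (\<lambda>t. F t * G t)"

definition multihomogeneous :: "nat \<Rightarrow> nat \<Rightarrow> nat \<Rightarrow> ((nat \<Rightarrow> tens) \<Rightarrow> complex) \<Rightarrow> bool" where
  "multihomogeneous m n s F \<longleftrightarrow> poly_fun s F \<and>
     (\<exists>d :: nat \<Rightarrow> nat. \<forall>c t. (\<forall>i<s. t i \<in> VS2W m n) \<longrightarrow>
        F (\<lambda>i. cscale (c i) (t i)) = (\<Prod>i<s. c i ^ d i) * F t)"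

text \<open>Zariski closed subsets of $\mathbb{P}(V \otimes S_2(W))^s$: common zero loci of
  multihomogeneous polynomials, evaluated at nonzero representatives of the points.\<close>

definition zariski_closed :: "nat \<Rightarrow> nat \<Rightarrow> nat \<Rightarrow> (nat \<Rightarrow> tens set) set \<Rightarrow> bool" where
  "zariski_closed m n s Z \<longleftrightarrow>
     (\<exists>\<F>. (\<forall>F\<in>\<F>. multihomogeneous m n s F) \<and>
        Z = {p \<in> {..<s} \<rightarrow>\<^sub>E proj_space m n.
               \<forall>F\<in>\<F>. \<forall>t \<in> (\<Pi>\<^sub>E i\<in>{..<s}. p i - {0}). F t = 0})"

text \<open>A property holds for general points $p_1, \dots, p_s$ of $X_{m,n}$ if it holds on a nonempty
  Zariski open subset of the (irreducible) variety $X_{m,n}^s$.\<close>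

definition for_general_points ::
  "nat \<Rightarrow> nat \<Rightarrow> nat \<Rightarrow> ((nat \<Rightarrow> tens set) \<Rightarrow> bool) \<Rightarrow> bool" where
  "for_general_points m n s P \<longleftrightarrow>
     (\<exists>Z. zariski_closed m n s Z \<and>
        ({..<s} \<rightarrow>\<^sub>E segre_veronese m n) - Z \<noteq> {} \<and>
        (\<forall>p \<in> ({..<s} \<rightarrow>\<^sub>E segre_veronese m n) - Z. P p))"

definition subspace_sum :: "nat \<Rightarrow> (nat \<Rightarrow> tens set) \<Rightarrow> tens set" where
  "subspace_sum s S = {(\<Sum>i<s. x i) | x. \<forall>i<s. x i \<in> S i}"

text \<open>The statement ``$T(m,n;1,2;s)$ is true''.\<close>

definition T12 :: "nat \<Rightarrow> nat \<Rightarrow> nat \<Rightarrow> bool" where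
  "T12 m n s \<longleftrightarrow> for_general_points m n s (\<lambda>p.
     cfun.dim (subspace_sum s (\<lambda>i. tangent_cone m n (p i))) =
       min (s * (m + n + 1)) ((m + 1) * ((n + 2) choose 2)))"

text \<open>The divisions by 2 in the three cases after \<open>k\<close> are exact.\<close>

definition s_lower :: "nat \<Rightarrow> nat \<Rightarrow> int" where
  "s_lower m n =
     (let k = int (n div 2); m' = int m in
      if even n then (m' + 1) * k - ((m' - 2) * (m' + 1)) div 2
      else if odd m then (m' + 1) * k - ((m' - 3) * (m' + 1)) div 2
      else (m' + 1) * k - ((m' - 3) * (m' + 1) + 1) div 2)"

end

theory Submission
  imports Defs "HOL-Computational_Algebra.Polynomial"
begin

text \<open>
  Put \<open>M = m + 1\<close>, \<open>N = n + 1\<close> and \<open>d = n + 2 - m\<close>. In all three cases \<open>s_lower m n\<close> is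
  the integer part of \<open>M d / 2\<close>, and for \<open>s\<close> up to this bound the expected dimension is
  \<open>s (m + n + 1)\<close>: the claim is that the tangent spaces at \<open>s\<close> general points
  \<open>[u\<^sub>i \<otimes> v\<^sub>i\<^sup>2]\<close> are independent and each of dimension \<open>m + n + 1\<close>. If \<open>u\<^sub>i\<close> has a nonzero
  coordinate \<open>b\<^sub>i\<close>, the tangent space is spanned by the \<open>m + n + 1\<close> vectors
  \<open>e\<^sub>a \<otimes> v\<^sub>i\<^sup>2\<close> with \<open>a \<noteq> b\<^sub>i\<close> and \<open>u\<^sub>i \<otimes> v\<^sub>i f\<^sub>c\<close>, where the \<open>e\<^sub>a\<close> and \<open>f\<^sub>c\<close> are the coordinate
  vectors. So linear independence of these generators is what has to be shown.

  Linear independence of a family depending polynomially on parameters is an open condition: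
  by fraction-free elimination it is implied by the nonvanishing of one polynomial, which does not
  vanish at a given parameter where independence holds, and which is (multi)homogeneous if the
  family is (\<open>lin_indep_open\<close>). Applied to generators written in terms of the coordinates of
  \<open>u\<^sub>i \<otimes> v\<^sub>i\<^sup>2\<close>, this gives the Zariski open set and reduces the theorem to one good configuration
  for each \<open>m\<close> and \<open>n\<close> (\<open>T12_of_indep_config\<close>).

  Good configurations of \<open>\<lfloor>M d / 2\<rfloor>\<close> points are found by induction on \<open>d\<close>, in steps of two
  (\<open>indep_config_exists\<close>). For \<open>d \<le> 1\<close> coordinate vectors do. When \<open>d\<close>, and with it \<open>n\<close>, grows by
  two, write \<open>W = W' \<oplus> E\<close> with \<open>E\<close> of dimension two; keep the old points, with \<open>v\<^sub>i \<in> W'\<close>, and add \<open>M\<close>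
  new ones. The family of generators is block triangular with respect to the quotient by
  \<open>V \<otimes> S\<^sub>2(W')\<close>, so it suffices that

  (A) the old generators belonging to \<open>W'\<close> are independent, which is the induction hypothesis, and

  (B) the remaining generators, \<open>u\<^sub>i \<otimes> v\<^sub>i E\<close> at the old points and all of them at the new points,
  are independent modulo \<open>V \<otimes> S\<^sub>2(W')\<close>.

  Both conditions are open, so they can be satisfied on different old points: on the line joining
  the two configurations, (A) and (B) each exclude only finitely many points
  (\<open>indep_config_step\<close>). For (B) an explicit configuration is available (\<open>conf_quotient_indep\<close>). Its
  new points are \<open>e\<^sub>j \<otimes> y\<^sub>j\<^sup>2\<close>, where the \<open>y\<^sub>j\<close> form a basis of \<open>Z \<oplus> E\<close> for a coordinate subspace
  \<open>Z \<subseteq> W'\<close> of codimension \<open>d\<close>. They absorb so much of the quotient that for the old points only a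
  condition on \<open>V \<otimes> W'/Z\<close> remains; it is met by points whose vectors \<open>u\<^sub>i = e\<^sub>r + e\<^sub>r\<^sub>'\<close>
  are the edges of cycles on the index set of \<open>V\<close>, one cycle for every two dimensions of
  \<open>W'/Z\<close> and disjoint edges for a last single dimension (\<open>edges_indep\<close>).
\<close>

section \<open>Linear independence as an open condition\<close>

text \<open>The family \<open>f\<close>, indexed by \<open>L\<close>, consists of vectors with coordinates in \<open>J\<close>; coordinates
  outside \<open>J\<close> are ignored, which serves to express independence in a quotient by a coordinate
  subspace. Unlike independence of the set \<open>f ` L\<close>, this excludes repetitions. It is meant for
  finite \<open>L\<close>.\<close>

definition lin_indep :: "'l set \<Rightarrow> 'j set \<Rightarrow> ('l \<Rightarrow> 'j \<Rightarrow> complex) \<Rightarrow> bool" where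
  "lin_indep L J f \<longleftrightarrow> (\<forall>c. (\<forall>j\<in>J. (\<Sum>l\<in>L. c l * f l j) = 0) \<longrightarrow> (\<forall>l\<in>L. c l = 0))"

lemma lin_indepD:
  "lin_indep L J f \<Longrightarrow> (\<And>j. j \<in> J \<Longrightarrow> (\<Sum>l\<in>L. c l * f l j) = 0) \<Longrightarrow> l \<in> L \<Longrightarrow> c l = 0"
  unfolding lin_indep_def by blast

lemma lin_indep_nonzero:
  assumes "lin_indep L J f" "l \<in> L"
  shows "\<exists>j\<in>J. f l j \<noteq> 0"
proof (rule ccontr)
  assume "\<not> ?thesis"
  then have *: "f l j = 0" if "j \<in> J" for j using that by blast
  have "(if l = l then 1 else 0 :: complex) = 0"
    by (rule lin_indepD[OF assms(1) _ assms(2), where c = "\<lambda>k. if k = l then 1 else 0"])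
       (auto intro!: sum.neutral simp: *)
  then show False by simp
qed

lemma lin_indep_scale:
  assumes "lin_indep L J f" and "\<And>l. l \<in> L \<Longrightarrow> r l \<noteq> 0"
  shows "lin_indep L J (\<lambda>l j. r l * f l j)"
  unfolding lin_indep_def
proof (intro allI impI ballI)
  fix c l assume "\<forall>j\<in>J. (\<Sum>l\<in>L. c l * (r l * f l j)) = 0" and l: "l \<in> L"
  then have "c l * r l = 0"
    by (intro lin_indepD[OF assms(1), where c = "\<lambda>l. c l * r l"]) (auto simp: mult.assoc)
  then show "c l = 0" using assms(2)[OF l] by simp
qed

lemma lin_indep_cong:
  "(\<And>l j. l \<in> L \<Longrightarrow> j \<in> J \<Longrightarrow> f l j = g l j) \<Longrightarrow> lin_indep L J f \<longleftrightarrow> lin_indep L J g"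
  unfolding lin_indep_def by simp

lemma lin_indep_subset:
  assumes "lin_indep L J f" "finite L" "K \<subseteq> L"
  shows "lin_indep K J f"
  unfolding lin_indep_def
proof (intro allI impI ballI)
  fix c l assume *: "\<forall>j\<in>J. (\<Sum>l\<in>K. c l * f l j) = 0" and l: "l \<in> K"
  have "(\<Sum>l\<in>L. (if l \<in> K then c l else 0) * f l j) = (\<Sum>l\<in>K. c l * f l j)" for j
    using assms(2,3) by (intro sum.mono_neutral_cong_right) auto
  with * l assms(3) have "(if l \<in> K then c l else 0) = 0"
    by (intro lin_indepD[OF assms(1), where c = "\<lambda>l. if l \<in> K then c l else 0"]) auto
  with l show "c l = 0" by simp
qed

text \<open>Block triangular families: \<open>B\<close> is independent modulo the coordinates outside \<open>K\<close>, and
  \<open>A\<close> lives in these coordinates.\<close>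

lemma lin_indep_block:
  assumes A: "lin_indep A J f" and B: "lin_indep B K f" and fin: "finite A" "finite B"
    and disj: "A \<inter> B = {}" and KJ: "K \<subseteq> J"
    and zero: "\<And>l j. l \<in> A \<Longrightarrow> j \<in> K \<Longrightarrow> f l j = 0"
  shows "lin_indep (A \<union> B) J f"
  unfolding lin_indep_def
proof (intro allI impI ballI)
  fix c l assume *: "\<forall>j\<in>J. (\<Sum>l\<in>A \<union> B. c l * f l j) = 0" and l: "l \<in> A \<union> B"
  have split: "(\<Sum>l\<in>A. c l * f l j) + (\<Sum>l\<in>B. c l * f l j) = 0" if "j \<in> J" for j
    using * that by (simp add: sum.union_disjoint fin disj)
  have cB: "c l = 0" if "l \<in> B" for l
  proof (rule lin_indepD[OF B _ that])
    fix j assume j: "j \<in> K"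
    then have "(\<Sum>l\<in>A. c l * f l j) = 0" by (simp add: zero)
    with split[of j] j KJ show "(\<Sum>l\<in>B. c l * f l j) = 0" by auto
  qed
  have "c l = 0" if "l \<in> A" for l
    by (rule lin_indepD[OF A _ that]) (use split cB in auto)
  with cB l show "c l = 0" by blast
qed

text \<open>\<open>H d F\<close> is to be read as ``\<open>F\<close> is a polynomial function, homogeneous of degree \<open>d\<close>'', for a
  grading left to the application. The induction performs one step of fraction-free elimination: a
  coordinate \<open>i\<close> of the vector \<open>l\<close> that is nonzero at \<open>p0\<close> is cleared from the other vectors, and \<open>F\<close>
  is the product of the pivots.\<close>

lemma lin_indep_open:
  fixes H :: "'d::comm_monoid_add \<Rightarrow> ('p \<Rightarrow> complex) \<Rightarrow> bool"
  assumes H_one: "H 0 (\<lambda>p. 1)"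
    and H_mult: "\<And>d e F G. H d F \<Longrightarrow> H e G \<Longrightarrow> H (d + e) (\<lambda>p. F p * G p)"
    and H_diff: "\<And>d F G. H d F \<Longrightarrow> H d G \<Longrightarrow> H d (\<lambda>p. F p - G p)"
    and "finite L"
    and "\<And>l j. l \<in> L \<Longrightarrow> j \<in> J \<Longrightarrow> H (\<delta> l) (\<lambda>p. g l p j)"
    and "lin_indep L J (\<lambda>l. g l p0)"
  shows "\<exists>F D. H D F \<and> F p0 \<noteq> 0 \<and> (\<forall>p. F p \<noteq> 0 \<longrightarrow> lin_indep L J (\<lambda>l. g l p))"
  using assms(4-6)
proof (induction L arbitrary: g \<delta> rule: finite_induct)
  case empty
  show ?case
    by (rule exI[of _ "\<lambda>p. 1"], rule exI[of _ 0]) (use H_one in \<open>auto simp: lin_indep_def\<close>)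
next
  case (insert l L)
  from lin_indep_nonzero[OF insert.prems(2)] obtain i where i: "i \<in> J" "g l p0 i \<noteq> 0" by auto
  define g' where "g' = (\<lambda>k p j. g l p i * g k p j - g k p i * g l p j)"
  have "H (\<delta> l + \<delta> k) (\<lambda>p. g' k p j)" if "k \<in> L" "j \<in> J" for k j
    unfolding g'_def
    by (rule H_diff) (use H_mult insert.prems(1) that i add.commute in \<open>metis insert_iff\<close>)+
  moreover have "lin_indep L J (\<lambda>k. g' k p0)"
    unfolding lin_indep_def
  proof (intro allI impI ballI)
    fix c k assume c: "\<forall>j\<in>J. (\<Sum>k\<in>L. c k * g' k p0 j) = 0" and k: "k \<in> L"
    define c' where "c' = (\<lambda>k. if k = l then - (\<Sum>k\<in>L. c k * g k p0 i) else c k * g l p0 i)"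
    have "(\<Sum>k\<in>insert l L. c' k * g k p0 j) = 0" if "j \<in> J" for j
    proof -
      have "(\<Sum>k\<in>insert l L. c' k * g k p0 j)
          = - (\<Sum>k\<in>L. c k * g k p0 i) * g l p0 j + (\<Sum>k\<in>L. c k * g l p0 i * g k p0 j)"
        using insert.hyps by (auto simp: c'_def intro!: sum.cong)
      also have "\<dots> = (\<Sum>k\<in>L. c k * g' k p0 j)"
        by (simp add: g'_def algebra_simps sum_subtractf sum_distrib_left)
      finally show ?thesis using c that by simp
    qed
    then have "c' k = 0" by (rule lin_indepD[OF insert.prems(2)]) (use k in auto)
    with k insert.hyps i show "c k = 0" by (auto simp: c'_def split: if_splits)
  qed
  ultimately obtain F D where F: "H D F" "F p0 \<noteq> 0" "\<And>p. F p \<noteq> 0 \<Longrightarrow> lin_indep L J (\<lambda>k. g' k p)"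
    using insert.IH[of "\<lambda>k. \<delta> l + \<delta> k" g'] by blast
  have "lin_indep (insert l L) J (\<lambda>k. g k p)" if nz: "g l p i \<noteq> 0" "F p \<noteq> 0" for p
    unfolding lin_indep_def
  proof (intro allI impI)
    fix c assume "\<forall>j\<in>J. (\<Sum>k\<in>insert l L. c k * g k p j) = 0"
    then have c: "c l * g l p j + (\<Sum>k\<in>L. c k * g k p j) = 0" if "j \<in> J" for j
      using that insert.hyps by auto
    have cL: "c k = 0" if "k \<in> L" for k
    proof (rule lin_indepD[OF F(3)[OF nz(2)] _ that])
      fix j assume j: "j \<in> J"
      have "(\<Sum>k\<in>L. c k * g' k p j)
          = g l p i * (\<Sum>k\<in>L. c k * g k p j) - (\<Sum>k\<in>L. c k * g k p i) * g l p j"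
        by (simp add: g'_def algebra_simps sum_subtractf sum_distrib_left)
      also have "\<dots> = g l p i * (c l * g l p j + (\<Sum>k\<in>L. c k * g k p j))
          - (c l * g l p i + (\<Sum>k\<in>L. c k * g k p i)) * g l p j"
        by (simp add: algebra_simps)
      finally show "(\<Sum>k\<in>L. c k * g' k p j) = 0" using c[OF j] c[OF i(1)] by simp
    qed
    have "(\<Sum>k\<in>L. c k * g k p i) = 0" using cL by simp
    with c[OF i(1)] nz cL show "\<forall>k\<in>insert l L. c k = 0" by auto
  qed
  moreover have "H (\<delta> l + D) (\<lambda>p. g l p i * F p)"
    by (rule H_mult) (use insert.prems(1) i F in auto)
  ultimately show ?case using F i
    by (intro exI[of _ "\<lambda>p. g l p i * F p"] exI[of _ "\<delta> l + D"]) auto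
qed

section \<open>Generators of the tangent spaces\<close>

text \<open>The generators of the affine tangent spaces at the points \<open>u\<^sub>i \<otimes> v\<^sub>i\<^sup>2\<close>: the index \<open>(i, Inl a)\<close>
  stands for \<open>e\<^sub>a \<otimes> v\<^sub>i\<^sup>2\<close> and \<open>(i, Inr c)\<close> for \<open>2 u\<^sub>i \<otimes> v\<^sub>i f\<^sub>c\<close>, with the factor \<open>2\<close> avoiding
  the denominator in \<^const>\<open>symprod\<close>.\<close>

definition gen ::
  "(nat \<Rightarrow> nat \<Rightarrow> complex) \<Rightarrow> (nat \<Rightarrow> nat \<Rightarrow> complex) \<Rightarrow> nat \<times> (nat + nat) \<Rightarrow> tens" where
  "gen u v = (\<lambda>(i, l) (a, j, k). case l of
      Inl a' \<Rightarrow> (if a = a' then v i j * v i k else 0)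
    | Inr c \<Rightarrow> u i a * (v i j * of_bool (k = c) + v i k * of_bool (j = c)))"

lemma gen_simps:
  "gen u v (i, Inl a') (a, j, k) = (if a = a' then v i j * v i k else 0)"
  "gen u v (i, Inr c) (a, j, k) = u i a * (v i j * of_bool (k = c) + v i k * of_bool (j = c))"
  by (auto simp: gen_def)

text \<open>The indices of the generators at \<open>s\<close> points for \<open>dim V = M\<close> and \<open>dim W = N\<close>. The vectors
  \<open>u\<^sub>i \<otimes> v\<^sub>i\<^sup>2\<close> lie in both parts of the tangent space; leaving out \<open>e\<^sub>a \<otimes> v\<^sub>i\<^sup>2\<close> for \<open>a = b i\<close> removes
  this relation, and forces the coordinate \<open>b i\<close> of \<open>u\<^sub>i\<close> to be nonzero if the others are
  independent (see \<open>indep_config_nonzero\<close>).\<close>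

definition idx :: "nat \<Rightarrow> nat \<Rightarrow> nat \<Rightarrow> (nat \<Rightarrow> nat) \<Rightarrow> (nat \<times> (nat + nat)) set" where
  "idx s M N b = (SIGMA i:{..<s}. ({..<M} - {b i}) <+> {..<N})"

lemma finite_idx [simp]: "finite (idx s M N b)"
  by (auto simp: idx_def)

lemma card_idx:
  assumes "\<And>i. i < s \<Longrightarrow> b i < M"
  shows "card (idx s M N b) = s * (M - 1 + N)"
proof -
  have "card (idx s M N b) = (\<Sum>i<s. card (({..<M} - {b i}) <+> {..<N}))"
    unfolding idx_def by (rule card_SigmaI) auto
  also have "\<dots> = (\<Sum>i<s. M - 1 + N)"
    using assms by (intro sum.cong) (auto simp: card_Plus)
  finally show ?thesis by simp
qed

lemma mem_idx:
  "(i, Inl a) \<in> idx s M N b \<longleftrightarrow> i < s \<and> a < M \<and> a \<noteq> b i"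
  "(i, Inr c) \<in> idx s M N b \<longleftrightarrow> i < s \<and> c < N"
  by (auto simp: idx_def)

text \<open>A linear combination of generators is \<open>\<Sum>\<^sub>i x\<^sub>i \<otimes> v\<^sub>i\<^sup>2 + 2 u\<^sub>i \<otimes> v\<^sub>i w\<^sub>i\<close>, where the vectors \<open>x\<^sub>i\<close>
  and \<open>w\<^sub>i\<close> collect the coefficients. \<open>lin_indep_genI\<close> is the resulting criterion.\<close>

lemma sum_gen:
  fixes c :: "nat \<times> (nat + nat) \<Rightarrow> complex"
  assumes "L \<subseteq> {..<s} \<times> ({..<M} <+> {..<N})"
  defines "x \<equiv> \<lambda>i a. if (i, Inl a) \<in> L then c (i, Inl a) else 0"
  defines "w \<equiv> \<lambda>i e. if (i, Inr e) \<in> L then c (i, Inr e) else 0"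
  shows "(\<Sum>l\<in>L. c l * gen u v l (a, j, k)) =
    (\<Sum>i<s. x i a * v i j * v i k + u i a * (v i j * w i k + v i k * w i j))"
proof -
  define c' where "c' = (\<lambda>l. if l \<in> L then c l else 0)"
  have zx: "x i a = 0" if "\<not> a < M" for i a using that assms(1) by (auto simp: x_def)
  have zw: "w i e = 0" if "\<not> e < N" for i e using that assms(1) by (auto simp: w_def)
  have "(\<Sum>l\<in>L. c l * gen u v l (a, j, k))
      = (\<Sum>l\<in>{..<s} \<times> ({..<M} <+> {..<N}). c' l * gen u v l (a, j, k))"
    by (rule sum.mono_neutral_cong_left) (use assms(1) in \<open>auto simp: c'_def\<close>)
  also have "\<dots> = (\<Sum>i<s. \<Sum>l\<in>{..<M} <+> {..<N}. c' (i, l) * gen u v (i, l) (a, j, k))"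
    by (simp add: sum.cartesian_product)
  also have "\<dots> = (\<Sum>i<s. x i a * v i j * v i k + u i a * (v i j * w i k + v i k * w i j))"
  proof (rule sum.cong)
    fix i
    have "(\<Sum>l\<in>{..<M} <+> {..<N}. c' (i, l) * gen u v (i, l) (a, j, k))
        = (\<Sum>a'<M. x i a' * (if a = a' then v i j * v i k else 0)) +
          (\<Sum>e<N. w i e * (u i a * (v i j * of_bool (k = e) + v i k * of_bool (j = e))))"
      by (simp add: sum.Plus gen_simps c'_def x_def w_def)
    also have "(\<Sum>a'<M. x i a' * (if a = a' then v i j * v i k else 0)) = x i a * v i j * v i k"
      by (simp add: if_distrib[of "\<lambda>z. _ * z"] zx cong: if_cong)
    also have "(\<Sum>e<N. w i e * (u i a * (v i j * of_bool (k = e) + v i k * of_bool (j = e))))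
        = (\<Sum>e<N. if k = e then w i e * u i a * v i j else 0) +
          (\<Sum>e<N. if j = e then w i e * u i a * v i k else 0)"
      unfolding sum.distrib[symmetric] by (intro sum.cong) (auto simp: algebra_simps)
    also have "\<dots> = u i a * (v i j * w i k + v i k * w i j)"
      by (simp add: zw algebra_simps)
    finally show "(\<Sum>l\<in>{..<M} <+> {..<N}. c' (i, l) * gen u v (i, l) (a, j, k))
      = x i a * v i j * v i k + u i a * (v i j * w i k + v i k * w i j)" .
  qed simp
  finally show ?thesis .
qed

lemma lin_indep_genI:
  assumes "L \<subseteq> {..<s} \<times> ({..<M} <+> {..<N})"
    and "\<And>x w. (\<And>i a. (i, Inl a) \<notin> L \<Longrightarrow> x i a = 0) \<Longrightarrow> (\<And>i e. (i, Inr e) \<notin> L \<Longrightarrow> w i e = 0) \<Longrightarrow>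
      (\<And>a j k. (a, j, k) \<in> J \<Longrightarrow>
        (\<Sum>i<s. x i a * v i j * v i k + u i a * (v i j * w i k + v i k * w i j)) = 0) \<Longrightarrow>
      (\<forall>i a. x i a = 0) \<and> (\<forall>i e. w i e = (0 :: complex))"
  shows "lin_indep L J (gen u v)"
  unfolding lin_indep_def
proof (intro allI impI ballI)
  fix c l assume *: "\<forall>j\<in>J. (\<Sum>l\<in>L. c l * gen u v l j) = 0" and l: "l \<in> L"
  define x where "x = (\<lambda>i a. if (i, Inl a) \<in> L then c (i, Inl a) else 0)"
  define w where "w = (\<lambda>i e. if (i, Inr e) \<in> L then c (i, Inr e) else 0)"
  have "(\<forall>i a. x i a = 0) \<and> (\<forall>i e. w i e = 0)"
  proof (rule assms(2))
    fix a j k assume "(a, j, k) \<in> J"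
    with * show "(\<Sum>i<s. x i a * v i j * v i k + u i a * (v i j * w i k + v i k * w i j)) = 0"
      unfolding x_def w_def sum_gen[OF assms(1), symmetric] by blast
  qed (auto simp: x_def w_def)
  moreover obtain i t where "l = (i, t)" by (cases l)
  ultimately show "c l = 0" using l by (cases t) (auto simp: x_def w_def split: if_splits)
qed

section \<open>A configuration of edges\<close>

text \<open>The condition on the old points in the induction step is the following: for points
  \<open>(u\<^sub>i, v\<^sub>i) \<in> \<complex>\<^sup>M \<times> \<complex>\<^sup>d\<close> and unknown \<open>(x\<^sub>i, y\<^sub>i) \<in> \<complex>\<^sup>2\<close>, the equations
  \<open>\<Sum>\<^sub>i u\<^sub>i(a) (y\<^sub>i - a x\<^sub>i) v\<^sub>i = 0\<close> in \<open>\<complex>\<^sup>d\<close>, one for each \<open>a < M\<close>, have only the zero solution. These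
  are \<open>M d\<close> equations, so there is room for \<open>M d div 2\<close> points.

  The points are numbered \<open>i = e M + r\<close>. For each \<open>e < d div 2\<close> the \<open>u\<^sub>i\<close> run through the edges
  \<open>e\<^sub>r + e\<^sub>r\<^sub>+\<^sub>1\<close> of a cycle through all \<open>M\<close> indices, and the \<open>v\<^sub>i = (1, r)\<close> live in the coordinates
  \<open>2 e\<close> and \<open>2 e + 1\<close>. At each index only two edges of a cycle meet, and their vectors \<open>v\<^sub>i\<close> are
  independent. For odd \<open>d\<close> the last coordinate is used by \<open>M div 2\<close> disjoint edges.\<close>

text \<open>The successor of \<open>r\<close> modulo \<open>M\<close>.\<close>

definition cyc_suc :: "nat \<Rightarrow> nat \<Rightarrow> nat" where
  "cyc_suc M r = (if Suc r = M then 0 else Suc r)"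

text \<open>The vectors \<open>u\<^sub>i\<close> and \<open>v\<^sub>i\<close>, as functions of the coordinate.\<close>

definition edge_u :: "nat \<Rightarrow> nat \<Rightarrow> nat \<Rightarrow> nat \<Rightarrow> complex" where
  "edge_u M d i a = (let r = i mod M in
     if i div M < d div 2 then of_bool (a = r \<or> a = cyc_suc M r)
     else of_bool (a = 2 * r \<or> a = 2 * r + 1))"

definition edge_v :: "nat \<Rightarrow> nat \<Rightarrow> nat \<Rightarrow> nat \<Rightarrow> complex" where
  "edge_v M d i k = (let e = i div M in
     if e < d div 2 then (if k = 2 * e then 1 else if k = 2 * e + 1 then of_nat (i mod M) else 0)
     else of_bool (k = 2 * (d div 2)))"

lemma edge_u_cycle:
  "r < M \<Longrightarrow> e < d div 2 \<Longrightarrow> edge_u M d (e * M + r) a = of_bool (a = r \<or> a = cyc_suc M r)"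
  by (auto simp: edge_u_def)

lemma edge_v_cycle:
  "r < M \<Longrightarrow> e < d div 2 \<Longrightarrow>
    edge_v M d (e * M + r) k = (if k = 2 * e then 1 else if k = 2 * e + 1 then of_nat r else 0)"
  by (auto simp: edge_v_def)

lemma half_mult_eq: "M * d div 2 = d div 2 * M + (if odd d then M div 2 else (0::nat))"
proof (cases "even d")
  case True
  then show ?thesis by (auto elim!: evenE)
next
  case False
  then obtain h where h: "d = 2 * h + 1" by (auto elim!: oddE)
  have "M * d = M + 2 * (h * M)" by (simp add: h algebra_simps)
  then have "M * d div 2 = M div 2 + h * M" by simp
  then show ?thesis by (simp add: h)
qed

text \<open>The edges meeting at the index \<open>r + 1\<close> of a cycle are those numbered \<open>r\<close> and \<open>r + 1\<close>; the
  equations at this index decouple.\<close>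

lemma edges_cycle_step:
  fixes x y :: "nat \<Rightarrow> complex"
  assumes M: "2 \<le> M"
    and eq: "\<And>a k. a < M \<Longrightarrow> k < d \<Longrightarrow>
      (\<Sum>i<M * d div 2. edge_u M d i a * edge_v M d i k * (y i - of_nat a * x i)) = 0"
    and e: "e < d div 2" and r: "r < M"
  shows "y (e * M + r) - of_nat (cyc_suc M r) * x (e * M + r) = 0 \<and>
    y (e * M + cyc_suc M r) - of_nat (cyc_suc M r) * x (e * M + cyc_suc M r) = 0"
proof -
  define a where "a = cyc_suc M r"
  define f where "f = (\<lambda>i. y i - of_nat a * x i)"
  have a: "a < M" "a \<noteq> r" using M r by (auto simp: a_def cyc_suc_def)
  have lt: "e * M + t < M * d div 2" if "t < M" for t
  proof -
    have "e * M + t < Suc e * M" using that by simp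
    also have "\<dots> \<le> d div 2 * M" using e by (intro mult_right_mono) auto
    finally show ?thesis by (simp add: half_mult_eq)
  qed
  have sup: "i = e * M + r \<or> i = e * M + a"
    if nz: "edge_u M d i a * edge_v M d i k \<noteq> 0" and k: "k = 2 * e \<or> k = 2 * e + 1" for i k
  proof -
    have ie: "i div M = e"
      using nz k e by (auto simp: edge_v_def Let_def split: if_splits; presburger)
    have "a = i mod M \<or> a = cyc_suc M (i mod M)"
      using nz ie e by (auto simp: edge_u_def Let_def split: if_splits)
    moreover have "i mod M = r" if "a = cyc_suc M (i mod M)"
      using that by (auto simp: a_def cyc_suc_def split: if_splits)
    moreover have "i = e * M + i mod M" using ie by (metis div_mult_mod_eq)
    ultimately show ?thesis by metis
  qed
  \<comment> \<open>The equations in coordinates \<open>2 e\<close> and \<open>2 e + 1\<close> have determinant \<open>a - r\<close>.\<close>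
  have two: "edge_v M d (e * M + r) k * f (e * M + r) + edge_v M d (e * M + a) k * f (e * M + a) = 0"
    if k: "k = 2 * e \<or> k = 2 * e + 1" for k
  proof -
    have "(\<Sum>i<M * d div 2. edge_u M d i a * edge_v M d i k * f i)
        = (\<Sum>i\<in>{e * M + r, e * M + a}. edge_u M d i a * edge_v M d i k * f i)"
      by (rule sum.mono_neutral_right) (use lt[OF r] lt[OF a(1)] sup[OF _ k] in auto)
    moreover have "k < d" using k e by auto
    ultimately have "(\<Sum>i\<in>{e * M + r, e * M + a}. edge_u M d i a * edge_v M d i k * f i) = 0"
      using eq[OF a(1), of k] by (simp add: f_def)
    moreover have "edge_u M d (e * M + r) a = 1" "edge_u M d (e * M + a) a = 1"
      using r e a(1) by (auto simp: edge_u_cycle a_def)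
    ultimately show ?thesis using a(2) by simp
  qed
  have 1: "f (e * M + r) + f (e * M + a) = 0"
    using two[of "2 * e"] r a(1) e by (simp add: edge_v_cycle)
  have 2: "of_nat r * f (e * M + r) + of_nat a * f (e * M + a) = 0"
    using two[of "2 * e + 1"] r a(1) e by (simp add: edge_v_cycle)
  have "(of_nat r - of_nat a) * f (e * M + r) =
      (of_nat r * f (e * M + r) + of_nat a * f (e * M + a)) - of_nat a * (f (e * M + r) + f (e * M + a))"
    by (simp add: algebra_simps)
  with 1 2 a(2) have "f (e * M + r) = 0" by simp
  with 1 show ?thesis by (simp add: f_def a_def)
qed

lemma two_slopes_zero:
  fixes x y :: complex
  assumes "y - of_nat a * x = 0" "y - of_nat b * x = 0" "a \<noteq> b"
  shows "x = 0 \<and> y = 0"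
proof -
  have "(of_nat a - of_nat b) * x = 0" using assms(1,2) by (simp add: algebra_simps)
  with assms show ?thesis by auto
qed

text \<open>An edge with end points \<open>a\<close> and \<open>a'\<close> gets the equations \<open>y\<^sub>i = a x\<^sub>i\<close> and \<open>y\<^sub>i = a' x\<^sub>i\<close>.\<close>

lemma edges_indep:
  fixes x y :: "nat \<Rightarrow> complex"
  assumes M: "2 \<le> M"
    and eq: "\<And>a k. a < M \<Longrightarrow> k < d \<Longrightarrow>
      (\<Sum>i<M * d div 2. edge_u M d i a * edge_v M d i k * (y i - of_nat a * x i)) = 0"
    and i: "i < M * d div 2"
  shows "x i = 0 \<and> y i = 0"
proof (cases "i div M < d div 2")
  case True
  define e r where "e = i div M" and "r = i mod M"
  have ir: "i = e * M + r" "e < d div 2" "r < M" using True M by (auto simp: e_def r_def)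
  define r0 where "r0 = (if r = 0 then M - 1 else r - 1)"
  have r0: "r0 < M" "cyc_suc M r0 = r" using M ir by (auto simp: r0_def cyc_suc_def)
  have "y i - of_nat r * x i = 0"
    using edges_cycle_step[OF M eq ir(2) r0(1)] r0 ir by simp
  moreover have "y i - of_nat (cyc_suc M r) * x i = 0"
    using edges_cycle_step[OF M eq ir(2,3)] ir by simp
  moreover have "r \<noteq> cyc_suc M r" using M by (auto simp: cyc_suc_def)
  ultimately show ?thesis by (rule two_slopes_zero)
next
  case False
  define r where "r = i mod M"
  have ge: "d div 2 * M \<le> i" using False by (metis div_times_less_eq_dividend linorder_not_less mult.commute
        mult_le_mono2 nle_le order_trans)
  with i have odd: "odd d" and "i - d div 2 * M < M div 2"
    by (auto simp: half_mult_eq split: if_splits)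
  moreover have "M div 2 < M" using M by auto
  ultimately have "i - d div 2 * M < M" by simp
  then have rM: "r = i - d div 2 * M"
    using ge by (metis mod_less mod_mult_self3 le_add_diff_inverse r_def)
  then have r2: "r < M div 2" using \<open>i - d div 2 * M < M div 2\<close> by simp
  have slope: "y i - of_nat a * x i = 0" if a: "a = 2 * r \<or> a = 2 * r + 1" for a
  proof -
    have aM: "a < M" using a r2 by auto
    have dd: "2 * (d div 2) < d" using odd by presburger
    have only: "j = i" if nz: "edge_u M d j a * edge_v M d j (2 * (d div 2)) \<noteq> 0" and j: "j < M * d div 2" for j
    proof -
      have jd: "\<not> j div M < d div 2"
        using nz dd by (auto simp: edge_v_def Let_def split: if_splits; presburger)
      then have ge': "d div 2 * M \<le> j" by (metis div_times_less_eq_dividend linorder_not_less mult.commute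
        mult_le_mono2 nle_le order_trans)
      have "j - d div 2 * M < M div 2" using j odd ge' by (auto simp: half_mult_eq)
      then have jM: "j mod M = j - d div 2 * M"
        using ge' \<open>M div 2 < M\<close> by (metis mod_less mod_mult_self3 le_add_diff_inverse order.strict_trans)
      have "a = 2 * (j mod M) \<or> a = 2 * (j mod M) + 1"
        using nz jd by (auto simp: edge_u_def Let_def split: if_splits)
      moreover have "t = r" if "a = 2 * t \<or> a = 2 * t + 1" for t using that a by presburger
      ultimately have "j mod M = r" by blast
      with jM rM ge ge' show "j = i" by (metis le_add_diff_inverse)
    qed
    have "(\<Sum>j<M * d div 2. edge_u M d j a * edge_v M d j (2 * (d div 2)) * (y j - of_nat a * x j))
        = (\<Sum>j\<in>{i}. edge_u M d j a * edge_v M d j (2 * (d div 2)) * (y j - of_nat a * x j))"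
      by (rule sum.mono_neutral_right) (use i only in auto)
    moreover have "edge_u M d i a = 1" "edge_v M d i (2 * (d div 2)) = 1"
      using False a by (auto simp: edge_u_def edge_v_def r_def)
    ultimately show ?thesis using eq[OF aM dd] by simp
  qed
  show ?thesis by (rule two_slopes_zero[OF slope[OF disjI1[OF refl]] slope[OF disjI2[OF refl]]]) simp
qed

section \<open>Configurations with independent tangent spaces\<close>

text \<open>The first \<open>s\<close> pairs \<open>(u\<^sub>i, v\<^sub>i)\<close> give points \<open>u\<^sub>i \<otimes> v\<^sub>i\<^sup>2\<close>, with \<open>dim V = M\<close> and \<open>dim W = N\<close>, whose
  tangent spaces are independent and of dimension \<open>M + N - 1\<close>. That \<open>u\<^sub>i\<close> and \<open>v\<^sub>i\<close> are nonzero
  follows when \<open>M \<ge> 2\<close>.\<close>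

definition indep_config :: "nat \<Rightarrow> nat \<Rightarrow> nat \<Rightarrow>
    (nat \<Rightarrow> nat \<Rightarrow> complex) \<Rightarrow> (nat \<Rightarrow> nat \<Rightarrow> complex) \<Rightarrow> (nat \<Rightarrow> nat) \<Rightarrow> bool" where
  "indep_config M N s u v b \<longleftrightarrow>
     (\<forall>i<s. u i \<in> cspace M \<and> v i \<in> cspace N \<and> b i < M) \<and> lin_indep (idx s M N b) UNIV (gen u v)"

lemma idx_subset: "idx s M N b \<subseteq> {..<s} \<times> ({..<M} <+> {..<N})"
  by (auto simp: idx_def)

lemma indep_config_mono:
  assumes "indep_config M N s' u v b" "s \<le> s'"
  shows "indep_config M N s u v b"
proof -
  have "idx s M N b \<subseteq> idx s' M N b" using assms(2) by (auto simp: idx_def)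
  then have "lin_indep (idx s M N b) UNIV (gen u v)"
    using assms(1) by (auto simp: indep_config_def intro: lin_indep_subset)
  then show ?thesis using assms by (auto simp: indep_config_def)
qed

text \<open>The points \<open>e\<^sub>i \<otimes> f\<^sub>i\<^sup>2\<close> will do.\<close>

lemma indep_config_coordinate:
  assumes "s \<le> M" "s \<le> N"
  shows "\<exists>u v b. indep_config M N s u v b"
proof -
  define \<delta> where "\<delta> = (\<lambda>i a :: nat. of_bool (a = i) :: complex)"
  have "lin_indep (idx s M N id) UNIV (gen \<delta> \<delta>)"
  proof (rule lin_indep_genI[OF idx_subset], goal_cases)
    case (1 x w)
    have X: "x i a = 0" if "i \<ge> s \<or> a = i" for i a using that 1(1)[of i a] by (auto simp: mem_idx)
    have W: "w i e = 0" if "i \<ge> s" for i e using that 1(2)[of i e] by (auto simp: mem_idx)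
    have one: "(\<Sum>i<s. f i * \<delta> i k) = (if k < s then f k else 0)" for f :: "nat \<Rightarrow> complex" and k
      by (simp add: \<delta>_def if_distrib[of "\<lambda>z. _ * z"] of_bool_def cong: if_cong)
    have E: "(\<Sum>i<s. x i a * \<delta> i j * \<delta> i k) +
        ((\<Sum>i<s. \<delta> i a * \<delta> i j * w i k) + (\<Sum>i<s. \<delta> i a * \<delta> i k * w i j)) = 0" for a j k
      using 1(3)[of a j k] by (simp add: sum.distrib algebra_simps)
    have pick: "(\<Sum>i<s. \<delta> i a * \<delta> i j * f i) = (if a = j \<and> j < s then f j else 0)"
      for f :: "nat \<Rightarrow> complex" and a j
    proof -
      have "(\<Sum>i<s. \<delta> i a * \<delta> i j * f i) = (\<Sum>i<s. (of_bool (a = j) * f i) * \<delta> i j)"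
        by (rule sum.cong) (auto simp: \<delta>_def)
      then show ?thesis by (simp add: one)
    qed
    have E': "(if j = k \<and> k < s then x k a else 0) +
        ((if a = j \<and> j < s then w j k else 0) + (if a = k \<and> k < s then w k j else 0)) = 0" for a j k
    proof -
      have "(\<Sum>i<s. x i a * \<delta> i j * \<delta> i k) = (if j = k \<and> k < s then x k a else 0)"
        using pick[of j k "\<lambda>i. x i a"] by (simp add: mult_ac)
      then show ?thesis using E[of a j k] by (simp add: pick)
    qed
    have "x i a = 0" for i a
      using E'[of i i a] X[of i a] by (cases "i < s"; cases "a = i") auto
    moreover have "w i e = 0" for i e
      using E'[of i e i] W[of i e] X[of i i] by (cases "i < s"; cases "e = i") auto
    ultimately show ?case by blast
  qed
  then have "indep_config M N s \<delta> \<delta> id"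
    using assms by (auto simp: indep_config_def cspace_def \<delta>_def)
  then show ?thesis by blast
qed

lemma sum_lessThan_add:
  "(\<Sum>i<a + b. f i) = (\<Sum>i<a. f i) + (\<Sum>t<b. f (a + t :: nat) :: 'a::comm_monoid_add)"
  by (induction b) (auto simp: add.assoc)

text \<open>The configuration for condition (B). Here \<open>dim W' = M - 2 + d\<close>, where \<open>Z\<close> is spanned by the first
  \<open>M - 2\<close> coordinates, and \<open>E\<close> has the two coordinates after those of \<open>W'\<close>. The points numbered
  below \<open>M d div 2\<close> are the edges of the previous section, with \<open>\<complex>\<^sup>d\<close> placed in the last \<open>d\<close>
  coordinates of \<open>W'\<close>. The \<open>j\<close>-th of the \<open>M\<close> others is \<open>e\<^sub>j \<otimes> y\<^sub>j\<^sup>2\<close>, where \<open>y\<^sub>j\<close> has the component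
  \<open>(1, j)\<close> in \<open>E\<close>, and the coordinate vector \<open>j - 2\<close> as its component in \<open>Z\<close> (zero for \<open>j < 2\<close>).\<close>

definition conf_u :: "nat \<Rightarrow> nat \<Rightarrow> nat \<Rightarrow> nat \<Rightarrow> complex" where
  "conf_u M d i a =
     (if i < M * d div 2 then of_bool (a < M) * edge_u M d i a else of_bool (a = i - M * d div 2))"

definition conf_v :: "nat \<Rightarrow> nat \<Rightarrow> nat \<Rightarrow> nat \<Rightarrow> complex" where
  "conf_v M d i k =
     (if i < M * d div 2 then of_bool (M - 2 \<le> k \<and> k < M - 2 + d) * edge_v M d i (k - (M - 2))
      else if k = M - 2 + d then 1
      else if k = Suc (M - 2 + d) then of_nat (i - M * d div 2)
      else of_bool (k < M - 2 \<and> k + 2 = i - M * d div 2))"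

text \<open>Condition (B). The coordinates \<open>(a, j, k)\<close> with \<open>N \<le> k\<close>, where \<open>N = dim W'\<close>, are those of the
  quotient by \<open>V \<otimes> S\<^sub>2(W')\<close>. At the \<open>j\<close>-th new point the index \<open>j\<close> is the one left out.

  The proof treats the equations in each \<open>a\<close> separately. With \<open>\<lambda>\<^sub>a(w) = w(N + 1) - a w(N)\<close>, the
  linear form on \<open>E\<close> vanishing on the component \<open>(1, a)\<close> of \<open>y\<^sub>a\<close>, the component in \<open>W'\<close> of the
  vector \<open>w\<^sub>a\<close> of the new point \<open>a\<close> is eliminated, and the unknowns \<open>\<xi>\<^sub>t = (t - a) x\<^sub>t(a)\<close> of the new points and
  \<open>\<theta> = \<lambda>\<^sub>a(w\<^sub>a)\<close> remain, subject to \<open>S1\<close>, \<open>S2\<close> (from \<open>S\<^sub>2(E)\<close>) and \<open>S3\<close> (from \<open>W' \<otimes> E\<close>).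
  The coordinates in \<open>Z\<close>, where the old points vanish, show that \<open>\<xi>\<close> and \<open>\<theta>\<close> are zero,
  and then \<open>S3\<close> is the system solved by \<open>edges_indep\<close>.\<close>

lemma conf_quotient_indep:
  fixes M d :: nat
  defines "s \<equiv> M * d div 2" and "N \<equiv> M - 2 + d"
  assumes M: "2 \<le> M"
  shows "lin_indep ({..<s} \<times> Inr ` {N, N + 1} \<union>
      (SIGMA i:{s..<s + M}. ({..<M} - {i - s}) <+> {..<N + 2})) {(a, j, k). N \<le> k}
    (gen (conf_u M d) (conf_v M d))"
    (is "lin_indep ?L ?J _")
proof (rule lin_indep_genI[of _ "s + M" M "N + 2"], goal_cases)
  case 1
  show ?case by auto
next
  case (2 x w)
  have x0: "x i a = 0" if "i < s \<or> i \<ge> s + M \<or> a \<ge> M \<or> i = s + a" for i a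
    by (rule 2(1)) (use that in auto)
  have w0: "w i e = 0" if "i < s \<and> e < N \<or> i \<ge> s + M \<or> e \<ge> N + 2" for i e
    by (rule 2(2)) (use that in auto)
  define y where "y = (\<lambda>t. conf_v M d (s + t))"
  have y: "y t N = 1" "y t (Suc N) = of_nat t" "k < N \<Longrightarrow> y t k = of_bool (k < M - 2 \<and> k + 2 = t)" for t k
    by (auto simp: y_def conf_v_def s_def[symmetric] N_def[symmetric])
  have vold: "conf_v M d i k = 0" if "i < s" "k \<ge> N \<or> k < M - 2" for i k
    using that by (auto simp: conf_v_def s_def N_def)
  have E: "(\<Sum>i<s. conf_u M d i a * conf_v M d i j * w i k) + (\<Sum>t<M. x (s + t) a * y t j * y t k) +
      (y a j * w (s + a) k + y a k * w (s + a) j) = 0" if "a < M" "N \<le> k" for a j k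
  proof -
    have "(\<Sum>i<s + M. x i a * conf_v M d i j * conf_v M d i k +
       conf_u M d i a * (conf_v M d i j * w i k + conf_v M d i k * w i j)) = 0"
      using 2(3)[of a j k] that by simp
    moreover have "(\<Sum>i<s. x i a * conf_v M d i j * conf_v M d i k +
       conf_u M d i a * (conf_v M d i j * w i k + conf_v M d i k * w i j)) =
      (\<Sum>i<s. conf_u M d i a * conf_v M d i j * w i k)"
      by (rule sum.cong) (use that in \<open>auto simp: x0 vold\<close>)
    moreover have "(\<Sum>t<M. x (s + t) a * conf_v M d (s + t) j * conf_v M d (s + t) k +
       conf_u M d (s + t) a * (conf_v M d (s + t) j * w (s + t) k + conf_v M d (s + t) k * w (s + t) j)) =
      (\<Sum>t<M. x (s + t) a * y t j * y t k) +
      (\<Sum>t<M. if a = t then y t j * w (s + t) k + y t k * w (s + t) j else 0)"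
      unfolding sum.distrib[symmetric]
      by (rule sum.cong) (auto simp: y_def conf_u_def s_def)
    ultimately show ?thesis using that by (simp add: sum_lessThan_add add.assoc)
  qed
  \<comment> \<open>The old points have no component in \<open>E\<close> and drop out of the equations \<open>pp\<close>, \<open>pq\<close> and \<open>qq\<close>.\<close>
  define \<theta> where "\<theta> = (\<lambda>a. w (s + a) (Suc N) - of_nat a * w (s + a) N)"
  define \<xi> where "\<xi> = (\<lambda>a t. (of_nat t - of_nat a) * x (s + t) a)"
  have pp: "(\<Sum>t<M. x (s + t) a) + 2 * w (s + a) N = 0" if "a < M" for a
    using E[OF that, of N N] by (simp add: y vold)
  have pq: "(\<Sum>t<M. x (s + t) a * of_nat t) + w (s + a) (Suc N) + of_nat a * w (s + a) N = 0"
    if "a < M" for a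
    using E[OF that, of "Suc N" N] by (simp add: y vold add.assoc)
  have qq: "(\<Sum>t<M. x (s + t) a * of_nat t * of_nat t) + 2 * of_nat a * w (s + a) (Suc N) = 0"
    if "a < M" for a
    using E[OF that, of "Suc N" "Suc N"] by (simp add: y vold mult.assoc)
  have S1: "(\<Sum>t<M. \<xi> a t) + \<theta> a = 0" if "a < M" for a
  proof -
    have "(\<Sum>t<M. \<xi> a t) + \<theta> a =
      ((\<Sum>t<M. x (s + t) a * of_nat t) + w (s + a) (Suc N) + of_nat a * w (s + a) N) -
      of_nat a * ((\<Sum>t<M. x (s + t) a) + 2 * w (s + a) N)"
      by (simp add: \<xi>_def \<theta>_def algebra_simps sum_subtractf sum_distrib_left)
    then show ?thesis using pp[OF that] pq[OF that] by simp
  qed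
  have S2: "(\<Sum>t<M. \<xi> a t * (of_nat t - of_nat a)) = 0" if "a < M" for a
  proof -
    have "(\<Sum>t<M. \<xi> a t * (of_nat t - of_nat a)) =
      ((\<Sum>t<M. x (s + t) a * of_nat t * of_nat t) + 2 * of_nat a * w (s + a) (Suc N)) -
      2 * of_nat a * ((\<Sum>t<M. x (s + t) a * of_nat t) + w (s + a) (Suc N) + of_nat a * w (s + a) N) +
      of_nat a * of_nat a * ((\<Sum>t<M. x (s + t) a) + 2 * w (s + a) N)"
      by (simp add: \<xi>_def algebra_simps sum_subtractf sum.distrib sum_distrib_left)
    then show ?thesis using pp[OF that] pq[OF that] qq[OF that] by simp
  qed
  have S3: "(\<Sum>i<s. conf_u M d i a * conf_v M d i k * (w i (Suc N) - of_nat a * w i N)) +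
      (\<Sum>t<M. \<xi> a t * y t k) + y a k * \<theta> a = 0" if a: "a < M" for a k
  proof -
    let ?p = "(\<Sum>i<s. conf_u M d i a * conf_v M d i k * w i N) + (\<Sum>t<M. x (s + t) a * y t k * y t N) +
      (y a k * w (s + a) N + y a N * w (s + a) k)"
    let ?q = "(\<Sum>i<s. conf_u M d i a * conf_v M d i k * w i (Suc N)) +
      (\<Sum>t<M. x (s + t) a * y t k * y t (Suc N)) + (y a k * w (s + a) (Suc N) + y a (Suc N) * w (s + a) k)"
    have "(\<Sum>i<s. conf_u M d i a * conf_v M d i k * (w i (Suc N) - of_nat a * w i N)) +
      (\<Sum>t<M. \<xi> a t * y t k) + y a k * \<theta> a = ?q - of_nat a * ?p"
      by (simp add: \<xi>_def \<theta>_def y algebra_simps sum_subtractf sum_distrib_left)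
    then show ?thesis using E[OF a, of N k] E[OF a, of "Suc N" k] by simp
  qed
  have S4: "\<xi> a (k + 2) + of_bool (k + 2 = a) * \<theta> a = 0" if a: "a < M" and k: "k < M - 2" for a k
  proof -
    have yk: "y t k = of_bool (k + 2 = t)" for t using k by (simp add: y N_def)
    have "(\<Sum>t<M. \<xi> a t * y t k) = \<xi> a (k + 2)"
      using k by (simp add: yk of_bool_def if_distrib[of "\<lambda>z. _ * z"] cong: if_cong)
    then show ?thesis using S3[OF a, of k] k by (simp add: vold yk)
  qed
  have \<xi>0: "\<xi> a t = 0" if a: "a < M" and t: "t < M" for a t
  proof -
    have diag: "\<xi> a a = 0" by (simp add: \<xi>_def)
    have ge2: "\<xi> a t = 0" if "2 \<le> t" "t < M" for t
    proof -
      have "t - 2 < M - 2" "t - 2 + 2 = t" using that by auto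
      then show ?thesis using S4[OF a, of "t - 2"] diag by (cases "t = a") auto
    qed
    have sum2: "(\<Sum>t<M. \<xi> a t * g t) = \<xi> a 0 * g 0 + \<xi> a 1 * g 1" for g :: "nat \<Rightarrow> complex"
    proof -
      have "(\<Sum>t<M. \<xi> a t * g t) = (\<Sum>t\<in>{0, 1}. \<xi> a t * g t)"
        by (rule sum.mono_neutral_right) (use M ge2 in \<open>auto simp: not_less_eq_eq\<close>)
      then show ?thesis by simp
    qed
    \<comment> \<open>Only the two points with no component in \<open>Z\<close> are left.\<close>
    have lin: "\<xi> a 0 + \<xi> a 1 + \<theta> a = 0" using S1[OF a] sum2[of "\<lambda>_. 1"] by simp
    have quad: "\<xi> a 1 - of_nat a * (\<xi> a 0 + \<xi> a 1) = 0"
      using S2[OF a] sum2[of "\<lambda>t. of_nat t - of_nat a"] by (simp add: algebra_simps)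
    have "\<xi> a 0 = 0 \<and> \<xi> a 1 = 0"
    proof (cases "2 \<le> a")
      case True
      then have "a - 2 < M - 2" "a - 2 + 2 = a" using a by auto
      then have "\<theta> a = 0" using S4[OF a, of "a - 2"] diag by auto
      with lin quad show ?thesis by auto
    next
      case False
      then have "a = 0 \<or> a = 1" by auto
      then show ?thesis using diag quad by auto
    qed
    then show ?thesis using ge2[of t] t by (cases "t = 0 \<or> t = 1") auto
  qed
  have x: "x i a = 0" for i a
  proof (cases "i < s \<or> i \<ge> s + M \<or> a \<ge> M \<or> i = s + a")
    case False
    then obtain t where t: "i = s + t" "t < M" "t \<noteq> a"
      by (metis le_iff_add linorder_not_less nat_add_left_cancel_less)
    with False have "\<xi> a t = 0" by (intro \<xi>0) auto
    with t show ?thesis by (simp add: \<xi>_def)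
  qed (rule x0)
  have \<theta>: "\<theta> a = 0" if "a < M" for a using S1[OF that] \<xi>0[OF that] by simp
  have wN: "w (s + a) N = 0" if "a < M" for a using pp[OF that] by (simp add: x)
  have wSN: "w (s + a) (Suc N) = 0" if "a < M" for a using \<theta>[OF that] wN[OF that] by (simp add: \<theta>_def)
  have wold: "w i N = 0 \<and> w i (Suc N) = 0" if "i < s" for i
  proof (rule edges_indep[OF M, of d "\<lambda>i. w i (Suc N)" "\<lambda>i. w i N"])
    fix a k assume a: "a < M" and k: "k < d"
    have "(\<Sum>i<s. edge_u M d i a * edge_v M d i k * (w i (Suc N) - of_nat a * w i N)) =
      (\<Sum>i<s. conf_u M d i a * conf_v M d i (M - 2 + k) * (w i (Suc N) - of_nat a * w i N))"
      by (rule sum.cong) (use a k in \<open>auto simp: conf_u_def conf_v_def s_def\<close>)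
    also have "\<dots> = 0" using S3[OF a, of "M - 2 + k"] \<xi>0[OF a] \<theta>[OF a] by simp
    finally show "(\<Sum>i<M * d div 2. edge_u M d i a * edge_v M d i k *
      (w i (Suc N) - of_nat a * w i N)) = 0" by (simp add: s_def)
  qed (use that s_def in auto)
  have "w i e = 0" for i e
  proof -
    consider "i < s" | "i \<ge> s + M" | a where "i = s + a" "a < M"
      by (metis le_iff_add linorder_not_less nat_add_left_cancel_less)
    then show ?thesis
    proof cases
      case 1
      then show ?thesis using w0[of i e] wold[OF 1]
        by (cases "e < N \<or> e \<ge> N + 2"; cases "e = N"; cases "e = Suc N") auto
    next
      case 2
      then show ?thesis by (simp add: w0)
    next
      case 3
      have "w (s + a) e = 0" using E[OF 3(2), of N e] 3(2) wold wN by (simp add: x y)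
      with 3 show ?thesis by simp
    qed
  qed
  with x show ?case by blast
qed

text \<open>The induction step. The new configuration is taken on the line through the configuration of
  the induction hypothesis (at parameter \<open>0\<close>) and the one satisfying (B) (at parameter \<open>1\<close>). The
  new points, numbered from \<open>s\<close> on, are constant along the line.\<close>

lemma indep_config_step:
  fixes M d :: nat
  defines "s \<equiv> M * d div 2" and "N \<equiv> M - 2 + d"
  assumes M: "2 \<le> M" and IH: "indep_config M N s u v b"
  shows "\<exists>u v b. indep_config M (N + 2) (s + M) u v b"
proof -
  let ?u = "conf_u M d" and ?v = "conf_v M d"
  define b' where "b' = (\<lambda>i. if i < s then b i else i - s)"
  define A where "A = idx s M N b"
  define B where "B = {..<s} \<times> Inr ` {N, N + 1} \<union>
      (SIGMA i:{s..<s + M}. ({..<M} - {i - s}) <+> {..<N + 2})"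
  have fin: "finite A" "finite B" by (auto simp: A_def B_def)
  have AB: "idx (s + M) M (N + 2) b' = A \<union> B" "A \<inter> B = {}"
    by (auto simp: idx_def A_def B_def b'_def split: if_splits)
  define lu where "lu = (\<lambda>z i a. (1 - z) * (if i < s then u i a else ?u i a) + z * ?u i a)"
  define lv where "lv = (\<lambda>z i a. (1 - z) * (if i < s then v i a else ?v i a) + z * ?v i a)"
  \<comment> \<open>No grading is needed for polynomials in the parameter, so the degree is a dummy.\<close>
  define H where "H = (\<lambda>(_ :: nat) F. \<exists>p :: complex poly. F = poly p)"
  have H_const: "H k (\<lambda>z. c)" for k c
    unfolding H_def by (rule exI[of _ "[:c:]"]) auto
  have H_add: "H k (\<lambda>z. F z + G z)" if "H k F" "H k G" for k F G
    using that unfolding H_def by (elim exE, intro exI[of _ "_ + _"]) (auto simp: fun_eq_iff)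
  have H_diff: "H k (\<lambda>z. F z - G z)" if "H k F" "H k G" for k F G
    using that unfolding H_def by (elim exE, intro exI[of _ "_ - _"]) (auto simp: fun_eq_iff)
  have H_mult: "H k'' (\<lambda>z. F z * G z)" if "H k F" "H k' G" for k k' k'' F G
    using that unfolding H_def by (elim exE, intro exI[of _ "_ * _"]) (auto simp: fun_eq_iff)
  have H_if: "H k (\<lambda>z. if c then F z else 0)" if "H k F" for k c F
    using that H_const by (cases c) auto
  have H_line: "H k (\<lambda>z. (1 - z) * c + z * e)" for k c e
    unfolding H_def by (rule exI[of _ "[:c, e - c:]"]) (auto simp: algebra_simps)
  have H_lu: "H k (\<lambda>z. lu z i a)" "H k (\<lambda>z. lv z i a)" for k i a
    unfolding lu_def lv_def by (rule H_line)+
  have H_gen: "H 0 (\<lambda>z. gen (lu z) (lv z) l j)" for l j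
  proof -
    obtain i t a j' k where "l = (i, t)" "j = (a, j', k)" by (metis surj_pair)
    then show ?thesis
      by (cases t) (auto simp: gen_simps intro!: H_if H_mult[of 0 _ 0] H_lu H_add H_const)
  qed
  have open0: "\<exists>F D. H D F \<and> F z0 \<noteq> 0 \<and> (\<forall>z. F z \<noteq> 0 \<longrightarrow> lin_indep L J (gen (lu z) (lv z)))"
    if "lin_indep L J (gen (lu z0) (lv z0))" "finite L" for L J z0
    by (rule lin_indep_open[where \<delta> = "\<lambda>_. 0" and g = "\<lambda>l z. gen (lu z) (lv z) l"])
       (use that in \<open>auto intro: H_const H_mult H_diff H_gen\<close>)
  have "lin_indep A UNIV (gen u v)" using IH by (simp add: indep_config_def A_def)
  also have "?this \<longleftrightarrow> lin_indep A UNIV (gen (lu 0) (lv 0))"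
  proof (rule lin_indep_cong)
    fix l :: "nat \<times> (nat + nat)" and j :: "nat \<times> nat \<times> nat" assume "l \<in> A"
    then obtain i t a j' k where "l = (i, t)" "j = (a, j', k)" "i < s"
      by (cases l; cases j) (auto simp: A_def idx_def)
    then show "gen u v l j = gen (lu 0) (lv 0) l j"
      by (cases t) (auto simp: gen_simps lu_def lv_def)
  qed
  finally obtain F1 D1 where F1: "H D1 F1" "F1 0 \<noteq> 0"
      "\<And>z. F1 z \<noteq> 0 \<Longrightarrow> lin_indep A UNIV (gen (lu z) (lv z))"
    using open0 fin by blast
  have "lu 1 = ?u" "lv 1 = ?v" by (auto simp: lu_def lv_def)
  then have "lin_indep B {(a, j, k). N \<le> k} (gen (lu 1) (lv 1))"
    using conf_quotient_indep[OF M, of d] by (simp add: B_def s_def N_def)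
  then obtain F2 D2 where F2: "H D2 F2" "F2 1 \<noteq> 0"
      "\<And>z. F2 z \<noteq> 0 \<Longrightarrow> lin_indep B {(a, j, k). N \<le> k} (gen (lu z) (lv z))"
    using open0 fin by blast
  obtain p1 p2 where p: "F1 = poly p1" "F2 = poly p2" using F1(1) F2(1) by (auto simp: H_def)
  have "p1 * p2 \<noteq> 0" using F1(2) F2(2) p by auto
  then obtain z where "poly (p1 * p2) z \<noteq> 0" by (metis poly_all_0_iff_0)
  then have z: "F1 z \<noteq> 0" "F2 z \<noteq> 0" by (auto simp: p)
  have mem: "lu z i \<in> cspace M" "lv z i \<in> cspace (N + 2)" "b' i < M" if "i < s + M" for i
  proof -
    have "?u i \<in> cspace M" "?v i \<in> cspace (N + 2)"
      using that M by (auto simp: cspace_def conf_u_def conf_v_def s_def N_def)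
    moreover have "u i \<in> cspace M" "v i \<in> cspace (N + 2)" "b i < M" if "i < s"
      using IH that by (auto simp: indep_config_def cspace_def)
    ultimately show "lu z i \<in> cspace M" "lv z i \<in> cspace (N + 2)" "b' i < M"
      using that by (auto simp: lu_def lv_def cspace_def b'_def)
  qed
  have vanish: "lv z i k = 0" if "i < s" "N \<le> k" for i k
    using IH that by (auto simp: lv_def indep_config_def cspace_def conf_v_def s_def N_def)
  have "lin_indep (A \<union> B) UNIV (gen (lu z) (lv z))"
  proof (rule lin_indep_block[OF F1(3)[OF z(1)] F2(3)[OF z(2)] fin AB(2)])
    fix l :: "nat \<times> (nat + nat)" and j :: "nat \<times> nat \<times> nat" assume "l \<in> A" "j \<in> {(a, j, k). N \<le> k}"
    then obtain i t a j' k where "l = (i, t)" "j = (a, j', k)" "i < s" "N \<le> k" "(i, t) \<in> A"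
      by (cases l; cases j) (auto simp: A_def idx_def)
    then show "gen (lu z) (lv z) l j = 0"
      by (cases t) (auto simp: gen_simps vanish A_def mem_idx)
  qed auto
  with mem have "indep_config M (N + 2) (s + M) (lu z) (lv z) b'"
    by (auto simp: indep_config_def AB simp del: add_2_eq_Suc')
  then show ?thesis by blast
qed

lemma indep_config_exists:
  assumes M: "2 \<le> M"
  shows "\<exists>u v b. indep_config M (M - 2 + d) (M * d div 2) u v b"
proof (induction d rule: nat_less_induct)
  case (1 d)
  show ?case
  proof (cases "d \<le> 1")
    case True
    show ?thesis by (rule indep_config_coordinate) (use M True in \<open>cases d; force\<close>)+
  next
    case False
    then obtain e where d: "d = e + 2" by (metis add.commute le_Suc_ex not_less_eq_eq one_add_one plus_1_eq_Suc)
    then obtain u v b where "indep_config M (M - 2 + e) (M * e div 2) u v b"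
      using 1[rule_format, of e] by auto
    moreover have "M * d div 2 = M * e div 2 + M" "M - 2 + d = M - 2 + e + 2"
      by (simp_all add: d algebra_simps)
    ultimately show ?thesis using indep_config_step[OF M] by metis
  qed
qed

section \<open>General points of the Segre-Veronese variety\<close>

text \<open>If the coordinate \<open>b i\<close> of \<open>u\<^sub>i\<close> were zero, then \<open>u\<^sub>i \<otimes> v\<^sub>i\<^sup>2\<close> would still be a combination of the
  chosen \<open>e\<^sub>a \<otimes> v\<^sub>i\<^sup>2\<close>; as it is also a combination of the \<open>u\<^sub>i \<otimes> v\<^sub>i f\<^sub>c\<close>, the generators would be
  dependent.\<close>

lemma indep_config_nonzero:
  assumes M: "2 \<le> M" and C: "indep_config M N s u v b" and i: "i < s"
  shows "u i (b i) \<noteq> 0" "\<exists>h. v i h \<noteq> 0"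
proof -
  have b: "b i < M" and uv: "u i \<in> cspace M" "v i \<in> cspace N"
    and L: "lin_indep (idx s M N b) UNIV (gen u v)"
    using C i by (auto simp: indep_config_def)
  define a where "a = (if b i = 0 then 1 else 0 :: nat)"
  have "(i, Inl a) \<in> idx s M N b" using M i by (auto simp: mem_idx a_def)
  from lin_indep_nonzero[OF L this] obtain a' j k where "gen u v (i, Inl a) (a', j, k) \<noteq> 0"
    by (metis surj_pair)
  then show v: "\<exists>h. v i h \<noteq> 0" by (auto simp: gen_simps split: if_splits)
  show "u i (b i) \<noteq> 0"
  proof
    assume ub: "u i (b i) = 0"
    define c :: "nat \<times> (nat + nat) \<Rightarrow> complex" where
      "c = (\<lambda>(i', l). if i' = i then (case l of Inl a \<Rightarrow> u i a | Inr e \<Rightarrow> - v i e / 2) else 0)"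
    have sum0: "(\<Sum>l\<in>idx s M N b. c l * gen u v l (a, j, k)) = 0" for a j k
    proof -
      have 1: "(if (i', Inl a) \<in> idx s M N b then c (i', Inl a) else 0) = (if i' = i then u i a else 0)" for i'
        using i ub uv by (auto simp: mem_idx c_def cspace_def)
      have 2: "(if (i', Inr e) \<in> idx s M N b then c (i', Inr e) else 0)
          = (if i' = i then - v i e / 2 else 0)" for i' e
        using i uv by (auto simp: mem_idx c_def cspace_def)
      show ?thesis unfolding sum_gen[OF idx_subset] 1 2
        by (rule sum.neutral) (auto simp: algebra_simps)
    qed
    have c0: "c l = 0" if "l \<in> idx s M N b" for l
    proof (rule lin_indepD[OF L _ that])
      fix j :: "nat \<times> nat \<times> nat"
      obtain a j' k where "j = (a, j', k)" by (cases j)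
      then show "(\<Sum>l\<in>idx s M N b. c l * gen u v l j) = 0"
        using sum0 by simp
    qed
    obtain h where h: "v i h \<noteq> 0" using v by blast
    then have "h < N" using uv(2) by (metis (mono_tags, lifting) cspace_def linorder_not_less mem_Collect_eq)
    then have "c (i, Inr h) = 0" by (intro c0) (use i in \<open>auto simp: mem_idx\<close>)
    with h show False by (simp add: c_def)
  qed
qed

text \<open>The generators \<^const>\<open>gen\<close>, up to scalars, in terms of the coordinates of the tensors
  \<open>t\<^sub>i = u\<^sub>i \<otimes> v\<^sub>i\<^sup>2\<close>. The slice of \<open>t\<^sub>i\<close> at \<open>b i\<close> is a multiple of \<open>v\<^sub>i\<^sup>2\<close>, and the slice at \<open>h i\<close> is a
  multiple of \<open>u\<^sub>i \<otimes> v\<^sub>i\<close>; the factors are the coordinates \<open>b i\<close> of \<open>u\<^sub>i\<close> and \<open>h i\<close> of \<open>v\<^sub>i\<close>. Each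
  generator is linear in \<open>t\<^sub>i\<close>.\<close>

definition tgen ::
  "(nat \<Rightarrow> nat) \<Rightarrow> (nat \<Rightarrow> nat) \<Rightarrow> nat \<times> (nat + nat) \<Rightarrow> (nat \<Rightarrow> tens) \<Rightarrow> tens" where
  "tgen b h = (\<lambda>(i, l) t (a, j, k). case l of
      Inl a' \<Rightarrow> (if a = a' then t i (b i, j, k) else 0)
    | Inr c \<Rightarrow> t i (a, h i, j) * of_bool (k = c) + t i (a, h i, k) * of_bool (j = c))"

lemma tgen_simps:
  "tgen b h (i, Inl a') t (a, j, k) = (if a = a' then t i (b i, j, k) else 0)"
  "tgen b h (i, Inr c) t (a, j, k) = t i (a, h i, j) * of_bool (k = c) + t i (a, h i, k) * of_bool (j = c)"
  by (auto simp: tgen_def)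

lemma tensor_symprod_apply:
  "tensor u (symprod v w) (a, j, k) = u a * ((v j * w k + w j * v k) / 2)"
  "tensor u (symprod v v) (a, j, k) = u a * (v j * v k)"
  by (auto simp: tensor_def symprod_def)

lemma sum_fun_apply: "(\<Sum>i\<in>A. f i) x = (\<Sum>i\<in>A. f i x :: 'b::comm_monoid_add)"
  by (induction A rule: infinite_finite_induct) auto

lemma tangent_in_span:
  assumes t: "t i = tensor u (symprod v v)" and ub: "u (b i) \<noteq> 0" and vh: "v (h i) \<noteq> 0"
    and mem: "u \<in> cspace M" "x \<in> cspace M" "v \<in> cspace N" "w \<in> cspace N"
  shows "tensor x (symprod v v) + tensor u (symprod v w) \<in>
    cfun.span ((\<lambda>l. tgen b h (i, l) t) ` (({..<M} - {b i}) <+> {..<N}))" (is "_ \<in> cfun.span ?G")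
proof -
  let ?B = "u (b i)" and ?h = "v (h i)"
  \<comment> \<open>Write \<open>x = x' + r u\<close> with \<open>x' (b i) = 0\<close>, and move \<open>r u \<otimes> v\<^sup>2\<close> to the second summand.\<close>
  define r where "r = x (b i) / ?B"
  define \<alpha> where "\<alpha> = (\<lambda>a. (x a - r * u a) / ?B)"
  define \<beta> where "\<beta> = (\<lambda>c. (w c + r * v c) / (2 * ?h))"
  let ?T = "(\<Sum>a\<in>{..<M} - {b i}. cscale (\<alpha> a) (tgen b h (i, Inl a) t)) +
      (\<Sum>c<N. cscale (\<beta> c) (tgen b h (i, Inr c) t))"
  have "tensor x (symprod v v) + tensor u (symprod v w) = ?T"
  proof
    fix z :: "nat \<times> nat \<times> nat"
    obtain a j k where z: "z = (a, j, k)" by (metis surj_pair)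
    have \<alpha>M: "\<alpha> a = 0" if "\<not> a < M" for a
      using that mem by (auto simp: \<alpha>_def cspace_def)
    have \<alpha>B: "\<alpha> a * ?B = x a - r * u a" for a using ub by (simp add: \<alpha>_def)
    have \<alpha>b: "\<alpha> (b i) = 0" using ub by (simp add: \<alpha>_def r_def)
    have \<beta>h: "\<beta> c * ?h = (w c + r * v c) / 2" for c using vh by (simp add: \<beta>_def)
    have \<beta>N: "\<beta> c = 0" if "\<not> c < N" for c using that mem by (auto simp: \<beta>_def cspace_def)
    have "(\<Sum>a'\<in>{..<M} - {b i}. \<alpha> a' * tgen b h (i, Inl a') t z)
        = (\<Sum>a'<M. if a' = a then \<alpha> a * ?B * (v j * v k) else 0)"
      by (rule sum.mono_neutral_cong_left)
         (auto simp: z tgen_simps t tensor_symprod_apply \<alpha>b)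
    also have "\<dots> = (x a - r * u a) * (v j * v k)"
      by (simp add: \<alpha>B[symmetric] \<alpha>M)
    finally have 1: "(\<Sum>a'\<in>{..<M} - {b i}. \<alpha> a' * tgen b h (i, Inl a') t z) = \<dots>" .
    have "(\<Sum>c<N. \<beta> c * tgen b h (i, Inr c) t z)
        = (\<Sum>c<N. if k = c then \<beta> c * ?h * u a * v j else 0) +
          (\<Sum>c<N. if j = c then \<beta> c * ?h * u a * v k else 0)"
      unfolding sum.distrib[symmetric]
      by (intro sum.cong) (auto simp: z tgen_simps t tensor_symprod_apply algebra_simps)
    also have "\<dots> = \<beta> k * ?h * u a * v j + \<beta> j * ?h * u a * v k"
      by (simp add: \<beta>N)
    also have "\<dots> = (w k + r * v k) / 2 * u a * v j + (w j + r * v j) / 2 * u a * v k"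
      by (simp only: \<beta>h)
    finally have 2: "(\<Sum>c<N. \<beta> c * tgen b h (i, Inr c) t z) = \<dots>" .
    show "(tensor x (symprod v v) + tensor u (symprod v w)) z = ?T z"
      unfolding plus_fun_apply sum_fun_apply cscale_def 1 2
      unfolding z tensor_symprod_apply by (simp add: field_simps)
  qed
  moreover have "?T \<in> cfun.span ?G"
    by (intro cfun.span_add cfun.span_sum cfun.span_scale cfun.span_base) auto
  ultimately show ?thesis by simp
qed

lemma nonzero_funE: "(x :: 'a \<Rightarrow> complex) \<noteq> 0 \<Longrightarrow> (\<And>i. x i \<noteq> 0 \<Longrightarrow> P) \<Longrightarrow> P"
  by (auto simp: fun_eq_iff)

lemma tensor_square_nonzero:
  assumes "u \<noteq> 0" "v \<noteq> 0"
  shows "tensor u (symprod v v) \<noteq> 0"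
proof -
  obtain a where "u a \<noteq> 0" using assms(1) by (rule nonzero_funE)
  moreover obtain j where "v j \<noteq> 0" using assms(2) by (rule nonzero_funE)
  ultimately have "tensor u (symprod v v) (a, j, j) \<noteq> 0" by (simp add: tensor_symprod_apply)
  then show ?thesis by (metis zero_fun_apply)
qed

lemma segre_veronese_subset: "segre_veronese m n \<subseteq> proj_space m n"
proof
  fix p assume "p \<in> segre_veronese m n"
  then obtain u v where p: "p = proj_pt (tensor u (symprod v v))"
    and uv: "u \<in> cspace (m + 1)" "v \<in> cspace (n + 1)" "u \<noteq> 0" "v \<noteq> 0"
    by (auto simp: segre_veronese_def)
  have "symprod v v \<in> Sym2 (n + 1)" using uv by (auto simp: Sym2_def symprod_def cspace_def)
  then have "tensor u (symprod v v) \<in> VS2W m n"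
    unfolding VS2W_def by (intro cfun.span_base) (use uv in auto)
  with tensor_square_nonzero[OF uv(3,4)] show "p \<in> proj_space m n"
    by (auto simp: proj_space_def p)
qed

lemma lin_indep_inj_independent:
  assumes L: "lin_indep L UNIV f" and fin: "finite L"
  shows "inj_on f L" "cfun.independent (f ` L)"
proof -
  show inj: "inj_on f L"
  proof (rule inj_onI, rule ccontr)
    fix k l assume kl: "k \<in> L" "l \<in> L" "f k = f l" "k \<noteq> l"
    define c :: "'a \<Rightarrow> complex" where "c = (\<lambda>i. if i = k then 1 else if i = l then -1 else 0)"
    have "(\<Sum>i\<in>L. c i * f i j) = 0" for j
    proof -
      have "(\<Sum>i\<in>L. c i * f i j) = (\<Sum>i\<in>{k, l}. c i * f i j)"
        using kl fin by (intro sum.mono_neutral_right) (auto simp: c_def)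
      also have "\<dots> = f k j - f l j" using kl(4) by (simp add: c_def)
      finally show ?thesis using kl(3) by simp
    qed
    then have "c k = 0" by (rule lin_indepD[OF L _ kl(1)])
    then show False by (simp add: c_def)
  qed
  show "cfun.independent (f ` L)"
  proof (rule cfun.independent_if_scalars_zero)
    fix g x assume "(\<Sum>y\<in>f ` L. cscale (g y) y) = 0" and x: "x \<in> f ` L"
    then have sum0: "(\<Sum>l\<in>L. cscale (g (f l)) (f l)) = 0" by (simp add: sum.reindex inj)
    have "(\<Sum>l\<in>L. g (f l) * f l j) = 0" for j
      using fun_cong[OF sum0, of j] by (simp add: sum_fun_apply cscale_def)
    then show "g x = 0" using x lin_indepD[OF L, of "\<lambda>l. g (f l)"] by auto
  qed (use fin in simp)
qed

text \<open>Independent generators form a basis of the sum of the tangent spaces. The representatives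
  \<open>t\<^sub>i\<close> of the points may be any, and \<open>tangent_cone\<close> admits all factorisations of a point, so the
  spanning property is checked for every factorisation (\<open>rep\<close>).\<close>

lemma dim_tangent_sum:
  assumes m: "1 \<le> m" and b: "\<And>i. i < s \<Longrightarrow> b i < m + 1"
    and p: "p \<in> {..<s} \<rightarrow>\<^sub>E segre_veronese m n"
    and t: "\<And>i. i < s \<Longrightarrow> t i \<in> p i - {0}"
    and L: "lin_indep (idx s (m + 1) (n + 1) b) UNIV (\<lambda>l. tgen b h l t)"
  shows "cfun.dim (subspace_sum s (\<lambda>i. tangent_cone m n (p i))) = s * (m + n + 1)"
proof (rule cfun.dim_unique)
  let ?L = "idx s (m + 1) (n + 1) b"
  let ?g = "\<lambda>l. tgen b h l t"
  let ?B = "?g ` ?L"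
  show "cfun.independent ?B" by (rule lin_indep_inj_independent[OF L]) simp
  show "card ?B = s * (m + n + 1)"
    using lin_indep_inj_independent(1)[OF L] card_idx[of s b "m + 1" "n + 1"] b
    by (simp add: card_image add.assoc)
  have segre_rep: "\<exists>u v. p i = proj_pt (tensor u (symprod v v)) \<and>
      u \<in> cspace (m + 1) - {0} \<and> v \<in> cspace (n + 1) - {0}" if "i < s" for i
  proof -
    have "p i \<in> segre_veronese m n" using p that by (auto simp: PiE_iff)
    then show ?thesis unfolding segre_veronese_def by blast
  qed
  have rep: "\<exists>\<kappa>. \<kappa> \<noteq> 0 \<and> t i = tensor (cscale \<kappa> u) (symprod v v) \<and>
      cscale \<kappa> u (b i) \<noteq> 0 \<and> v (h i) \<noteq> 0"
    if i: "i < s" and pi: "p i = proj_pt (tensor u (symprod v v))" for i u v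
  proof -
    from t[OF i] obtain \<kappa> where \<kappa>: "t i = cscale \<kappa> (tensor u (symprod v v))" "t i \<noteq> 0"
      by (auto simp: pi proj_pt_def cfun.span_singleton)
    then have "\<kappa> \<noteq> 0" by (auto simp: cscale_def fun_eq_iff)
    moreover have ti: "t i = tensor (cscale \<kappa> u) (symprod v v)"
      unfolding \<kappa> by (auto simp: cscale_def tensor_def)
    moreover have "cscale \<kappa> u (b i) \<noteq> 0"
    proof -
      define a where "a = (if b i = 0 then 1 else 0 :: nat)"
      have "(i, Inl a) \<in> ?L" using m i by (auto simp: mem_idx a_def)
      from lin_indep_nonzero[OF L this] obtain a' j k where "tgen b h (i, Inl a) t (a', j, k) \<noteq> 0"
        by (metis surj_pair)
      then show ?thesis by (auto simp: tgen_simps ti tensor_symprod_apply split: if_splits)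
    qed
    moreover have "v (h i) \<noteq> 0"
    proof -
      have "(i, Inr 0) \<in> ?L" using i by (auto simp: mem_idx)
      from lin_indep_nonzero[OF L this] obtain a j k where "tgen b h (i, Inr 0) t (a, j, k) \<noteq> 0"
        by (metis surj_pair)
      then show ?thesis by (auto simp: tgen_simps ti tensor_symprod_apply)
    qed
    ultimately show ?thesis by blast
  qed
  show "subspace_sum s (\<lambda>i. tangent_cone m n (p i)) \<subseteq> cfun.span ?B"
  proof
    fix z assume "z \<in> subspace_sum s (\<lambda>i. tangent_cone m n (p i))"
    then obtain y where z: "z = (\<Sum>i<s. y i)" and y: "\<And>i. i < s \<Longrightarrow> y i \<in> tangent_cone m n (p i)"
      by (auto simp: subspace_sum_def)
    have "y i \<in> cfun.span ?B" if i: "i < s" for i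
    proof -
      obtain x u v w where yi: "y i = tensor x (symprod v v) + tensor u (symprod v w)"
        and mem: "x \<in> cspace (m + 1)" "w \<in> cspace (n + 1)" "u \<in> cspace (m + 1)" "v \<in> cspace (n + 1)"
        and pi: "p i = proj_pt (tensor u (symprod v v))"
        using y[OF i] by (auto simp: tangent_cone_def)
      obtain \<kappa> where \<kappa>: "\<kappa> \<noteq> 0" "t i = tensor (cscale \<kappa> u) (symprod v v)"
        "cscale \<kappa> u (b i) \<noteq> 0" "v (h i) \<noteq> 0"
        using rep[OF i pi] by blast
      have "tensor u (symprod v w) = tensor (cscale \<kappa> u) (symprod v (cscale (inverse \<kappa>) w))"
        using \<kappa>(1) by (auto simp: fun_eq_iff tensor_def symprod_def cscale_def field_simps)
      then have "y i = tensor x (symprod v v) + tensor (cscale \<kappa> u) (symprod v (cscale (inverse \<kappa>) w))"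
        by (simp add: yi)
      also have "\<dots> \<in> cfun.span ((\<lambda>l. tgen b h (i, l) t) ` (({..<m + 1} - {b i}) <+> {..<n + 1}))"
        by (rule tangent_in_span) (use mem \<kappa> in \<open>auto simp: cspace_def cscale_def\<close>)
      also have "\<dots> \<subseteq> cfun.span ?B"
        by (rule cfun.span_mono) (use i in \<open>auto simp: idx_def\<close>)
      finally show ?thesis .
    qed
    then show "z \<in> cfun.span ?B" unfolding z by (intro cfun.span_sum) auto
  qed
  show "?B \<subseteq> subspace_sum s (\<lambda>i. tangent_cone m n (p i))"
  proof
    fix z assume "z \<in> ?B"
    then obtain i l where z: "z = tgen b h (i, l) t" and il: "(i, l) \<in> ?L" by auto
    then have i: "i < s" by (auto simp: idx_def)
    have zero: "0 \<in> tangent_cone m n (p i)" if i: "i < s" for i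
    proof -
      obtain u v where "p i = proj_pt (tensor u (symprod v v))"
        and "u \<in> cspace (m + 1) - {0}" "v \<in> cspace (n + 1) - {0}"
        using segre_rep[OF i] by blast
      moreover have "(0 :: tens) = tensor 0 (symprod v v) + tensor u (symprod v 0)"
        by (auto simp: fun_eq_iff tensor_def symprod_def)
      moreover have "0 \<in> cspace d" for d by (auto simp: cspace_def)
      ultimately show ?thesis unfolding tangent_cone_def by blast
    qed
    have "z \<in> tangent_cone m n (p i)"
    proof -
      obtain u v where pi: "p i = proj_pt (tensor u (symprod v v))"
        and uv: "u \<in> cspace (m + 1) - {0}" "v \<in> cspace (n + 1) - {0}"
        using segre_rep[OF i] by blast
      obtain \<kappa> where \<kappa>: "\<kappa> \<noteq> 0" "t i = tensor (cscale \<kappa> u) (symprod v v)"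
        using rep[OF i pi] by blast
      define x where "x = (\<lambda>a. case l of Inl a' \<Rightarrow> of_bool (a = a') * \<kappa> * u (b i) | Inr c \<Rightarrow> 0)"
      define w where "w = (\<lambda>k. case l of Inl a' \<Rightarrow> 0 | Inr c \<Rightarrow> 2 * \<kappa> * v (h i) * of_bool (k = c))"
      have "z = tensor x (symprod v v) + tensor u (symprod v w)"
      proof
        fix y :: "nat \<times> nat \<times> nat"
        obtain a j k where y: "y = (a, j, k)" by (metis surj_pair)
        show "z y = (tensor x (symprod v v) + tensor u (symprod v w)) y"
          unfolding z y plus_fun_apply tensor_symprod_apply
          by (cases l) (auto simp: tgen_simps \<kappa> tensor_symprod_apply x_def w_def cscale_def algebra_simps)
      qed
      moreover have "x \<in> cspace (m + 1)" "w \<in> cspace (n + 1)"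
        using il by (auto simp: x_def w_def cspace_def mem_idx split: sum.split)
      ultimately show ?thesis unfolding tangent_cone_def using uv pi by blast
    qed
    then have "(if j = i then z else 0) \<in> tangent_cone m n (p j)" if "j < s" for j
      using zero that by auto
    moreover have "z = (\<Sum>j<s. if j = i then z else 0)" using i by simp
    ultimately show "z \<in> subspace_sum s (\<lambda>i. tangent_cone m n (p i))"
      unfolding subspace_sum_def by (intro CollectI exI[of _ "\<lambda>j. if j = i then z else 0"]) auto
  qed
qed

text \<open>The complement of the hypersurface \<open>F = 0\<close>, for the multihomogeneous polynomial \<open>F\<close> obtained from
  \<open>lin_indep_open\<close>, is the open set of general points; it contains the given configuration. Here a
  degree is a function assigning to each \<open>i\<close> the degree in \<open>t\<^sub>i\<close>.\<close>

lemma T12_of_indep_config: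
  assumes m: "1 \<le> m" and C: "indep_config (m + 1) (n + 1) s u v b"
    and le: "s * (m + n + 1) \<le> (m + 1) * ((n + 2) choose 2)"
  shows "T12 m n s"
proof -
  let ?L = "idx s (m + 1) (n + 1) b"
  have nz: "u i (b i) \<noteq> 0" "\<exists>h. v i h \<noteq> 0" if "i < s" for i
    using indep_config_nonzero[OF _ C that] m by auto
  obtain h where h: "v i (h i) \<noteq> 0" if "i < s" for i using nz(2) by metis
  have mem: "u i \<in> cspace (m + 1)" "v i \<in> cspace (n + 1)" "b i < m + 1" if "i < s" for i
    using C that by (auto simp: indep_config_def)
  define t0 where "t0 = (\<lambda>i\<in>{..<s}. tensor (u i) (symprod (v i) (v i)))"
  define H where "H = (\<lambda>d F. poly_fun s F \<and>
    (\<forall>c t. F (\<lambda>i. cscale (c i) (t i)) = (\<Prod>i<s. c i ^ d i) * F t))"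
  have H_mult: "H (d + e) (\<lambda>p. F p * G p)" if "H d F" "H e G" for d e F G
    using that unfolding H_def by (auto intro: poly_fun.mult simp: power_add prod.distrib mult_ac)
  have H_lin: "H d (\<lambda>p. F p + k * G p)" if "H d F" "H d G" for d F G k
    using that unfolding H_def
    by (auto intro!: poly_fun.add poly_fun.mult poly_fun.const simp: algebra_simps)
  have H_if: "H d (\<lambda>p. if c then F p else 0)" if "H d F" for d c F
    using that unfolding H_def by (cases c) (auto intro: poly_fun.const)
  have H_coord: "H (\<lambda>j. if j = i then 1 else 0) (\<lambda>t. t i a)" if "i < s" for i a
    unfolding H_def
    using that by (auto intro: poly_fun.coord simp: cscale_def if_distrib[of "\<lambda>k. _ ^ k"] cong: if_cong)
  define \<delta> where "\<delta> = (\<lambda>(i :: nat, l :: nat + nat) j. if j = i then 1 else 0 :: nat)"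
  have "\<exists>F D. H D F \<and> F t0 \<noteq> 0 \<and> (\<forall>t. F t \<noteq> 0 \<longrightarrow> lin_indep ?L UNIV (\<lambda>l. tgen b h l t))"
  proof (rule lin_indep_open[where \<delta> = \<delta> and g = "tgen b h" and J = UNIV])
    show "H 0 (\<lambda>p. 1)" unfolding H_def by (auto intro: poly_fun.const)
    show "H d (\<lambda>p. F p - G p)" if "H d F" "H d G" for d F G
      using H_lin[OF that, of "-1"] by simp
    show "H (\<delta> l) (\<lambda>t. tgen b h l t j)" if "l \<in> ?L" for l j
    proof -
      obtain i r a j' k where l: "l = (i, r)" and j: "j = (a, j', k)" by (metis surj_pair)
      have i: "i < s" using that by (auto simp: l idx_def)
      show ?thesis
      proof (cases r)
        case (Inl a')
        then have "(\<lambda>t. tgen b h l t j) = (\<lambda>t. if a = a' then t i (b i, j', k) else 0)"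
          by (simp add: fun_eq_iff l j tgen_simps)
        with H_if[OF H_coord[OF i]] show ?thesis by (simp add: l \<delta>_def)
      next
        case (Inr c)
        then have "(\<lambda>t. tgen b h l t j) = (\<lambda>t. (if k = c then t i (a, h i, j') else 0) +
            1 * (if j' = c then t i (a, h i, k) else 0))"
          by (simp add: fun_eq_iff l j tgen_simps)
        moreover have "H (\<lambda>j. if j = i then 1 else 0) (\<lambda>t. (if k = c then t i (a, h i, j') else 0) +
            1 * (if j' = c then t i (a, h i, k) else 0))"
          by (intro H_lin H_if H_coord i)
        ultimately show ?thesis by (simp add: l \<delta>_def)
      qed
    qed
    define \<rho> where "\<rho> = (\<lambda>(i, r :: nat + nat). case r of Inl a \<Rightarrow> u i (b i) | Inr c \<Rightarrow> v i (h i))"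
    have "lin_indep ?L UNIV (gen u v)" using C by (simp add: indep_config_def)
    then have "lin_indep ?L UNIV (\<lambda>l j. \<rho> l * gen u v l j)"
    proof (rule lin_indep_scale)
      fix l assume "l \<in> ?L"
      then obtain i r where "l = (i, r)" "i < s" by (cases l) (auto simp: idx_def)
      then show "\<rho> l \<noteq> 0" using nz(1) h by (cases r) (auto simp: \<rho>_def)
    qed
    also have "?this \<longleftrightarrow> lin_indep ?L UNIV (\<lambda>l. tgen b h l t0)"
    proof (rule lin_indep_cong)
      fix l :: "nat \<times> (nat + nat)" and j :: "nat \<times> nat \<times> nat" assume "l \<in> ?L"
      then obtain i r a j' k where l: "l = (i, r)" and j: "j = (a, j', k)" and "i < s"
        by (cases l; cases j) (auto simp: idx_def)
      then show "\<rho> l * gen u v l j = tgen b h l t0 j"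
        by (cases r) (auto simp: l j \<rho>_def gen_simps tgen_simps t0_def tensor_symprod_apply algebra_simps)
    qed
    finally show "lin_indep ?L UNIV (\<lambda>l. tgen b h l t0)" .
  qed (use H_mult in auto)
  then obtain F D where F: "H D F" "F t0 \<noteq> 0" "\<And>t. F t \<noteq> 0 \<Longrightarrow> lin_indep ?L UNIV (\<lambda>l. tgen b h l t)"
    by blast
  define Z where "Z = {p \<in> {..<s} \<rightarrow>\<^sub>E proj_space m n. \<forall>G\<in>{F}. \<forall>t \<in> (\<Pi>\<^sub>E i\<in>{..<s}. p i - {0}). G t = 0}"
  have "zariski_closed m n s Z"
    unfolding zariski_closed_def
  proof (intro exI[of _ "{F}"] conjI)
    show "\<forall>G\<in>{F}. multihomogeneous m n s G"
      using F(1) by (auto simp: H_def multihomogeneous_def)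
  qed (rule Z_def)
  moreover have "({..<s} \<rightarrow>\<^sub>E segre_veronese m n) - Z \<noteq> {}"
  proof -
    have nonz: "u i \<noteq> 0" "v i \<noteq> 0" if "i < s" for i using nz(1)[OF that] h[OF that] by auto
    let ?p = "\<lambda>i\<in>{..<s}. proj_pt (t0 i)"
    have "?p \<in> {..<s} \<rightarrow>\<^sub>E segre_veronese m n"
      using nonz mem by (fastforce simp: segre_veronese_def t0_def)
    moreover have "t0 \<in> (\<Pi>\<^sub>E i\<in>{..<s}. ?p i - {0})"
      using nonz by (auto simp: t0_def proj_pt_def tensor_square_nonzero intro: cfun.span_base)
    then have "?p \<notin> Z" using F(2) by (auto simp: Z_def)
    ultimately show ?thesis by blast
  qed
  moreover have "cfun.dim (subspace_sum s (\<lambda>i. tangent_cone m n (p i))) =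
       min (s * (m + n + 1)) ((m + 1) * ((n + 2) choose 2))"
    if p: "p \<in> ({..<s} \<rightarrow>\<^sub>E segre_veronese m n) - Z" for p
  proof -
    have "p \<in> {..<s} \<rightarrow>\<^sub>E proj_space m n" using p segre_veronese_subset by fastforce
    then obtain t where t: "t \<in> (\<Pi>\<^sub>E i\<in>{..<s}. p i - {0})" "F t \<noteq> 0"
      using p by (auto simp: Z_def)
    have "cfun.dim (subspace_sum s (\<lambda>i. tangent_cone m n (p i))) = s * (m + n + 1)"
      by (rule dim_tangent_sum[OF m, of s b _ _ t h]) (use p t mem F(3) in auto)
    with le show ?thesis by simp
  qed
  ultimately show ?thesis unfolding T12_def for_general_points_def by blast
qed

section \<open>The numerical bounds\<close>

lemma s_lower_bound:
  assumes "m \<le> n + 2" "int s \<le> s_lower m n"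
  shows "s \<le> (m + 1) * (n + 2 - m) div 2"
proof -
  define k where "k = int (n div 2)"
  have "2 * s_lower m n \<le> (int m + 1) * (int n + 2 - int m)"
  proof (cases "even n")
    case True
    define D where "D = ((int m - 2) * (int m + 1)) div 2"
    have D: "2 * D = (int m - 2) * (int m + 1)"
      unfolding D_def by (intro dvd_mult_div_cancel) auto
    have "s_lower m n = (int m + 1) * k - D"
      using True by (simp add: s_lower_def Let_def k_def D_def)
    moreover have n: "int n = 2 * k" using True by (simp add: k_def zdiv_int)
    ultimately show ?thesis unfolding n using D by (simp add: algebra_simps)
  next
    case False
    then have n: "int n = 2 * k + 1" unfolding k_def by presburger
    show ?thesis
    proof (cases "odd m")
      case True
      define D where "D = ((int m - 3) * (int m + 1)) div 2"
      have D: "2 * D = (int m - 3) * (int m + 1)"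
        unfolding D_def by (intro dvd_mult_div_cancel) (use True in auto)
      have "s_lower m n = (int m + 1) * k - D"
        using False True by (simp add: s_lower_def Let_def k_def D_def)
      then show ?thesis unfolding n using D by (simp add: algebra_simps)
    next
      case m: False
      define D where "D = ((int m - 3) * (int m + 1) + 1) div 2"
      have D: "2 * D = (int m - 3) * (int m + 1) + 1"
        unfolding D_def by (intro dvd_mult_div_cancel) (use m in auto)
      have "s_lower m n = (int m + 1) * k - D"
        using False m by (simp add: s_lower_def Let_def k_def D_def)
      then show ?thesis unfolding n using D by (simp add: algebra_simps)
    qed
  qed
  moreover have "int ((m + 1) * (n + 2 - m)) = (int m + 1) * (int n + 2 - int m)"
    using assms(1) by (simp only: of_nat_mult of_nat_add of_nat_diff) simp
  ultimately have "2 * s \<le> (m + 1) * (n + 2 - m)" using assms(2) by linarith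
  then show ?thesis by simp
qed

text \<open>With \<open>n + 2 = m + d\<close>, the inequality comes down to
  \<open>(n + 2) (n + 1) - d (m + n + 1) = m (m - 1) \<ge> 0\<close>.\<close>

lemma subabundant:
  assumes m: "1 \<le> m" and mn: "m \<le> n + 2" and s: "s \<le> (m + 1) * (n + 2 - m) div 2"
  shows "s * (m + n + 1) \<le> (m + 1) * ((n + 2) choose 2)"
proof -
  obtain m' where m': "m = m' + 1" using m by (metis add.commute le_Suc_ex)
  obtain d where d: "n + 2 = m + d" using mn by (metis le_iff_add)
  then have n1: "n + 1 = m' + d" by (simp add: m')
  have "d * (m + n + 1) \<le> (n + 2) * (n + 1)"
    unfolding add.assoc[of m n 1] n1 d by (simp add: m' algebra_simps)
  have "2 * s \<le> (m + 1) * d" using s d by simp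
  then have "2 * s * (m + n + 1) \<le> (m + 1) * d * (m + n + 1)" by (rule mult_right_mono) simp
  also have "\<dots> = (m + 1) * (d * (m + n + 1))" by (simp only: mult.assoc)
  also have "\<dots> \<le> (m + 1) * ((n + 2) * (n + 1))" using \<open>d * (m + n + 1) \<le> _\<close> by (rule mult_left_mono) simp
  also have "(n + 2) * (n + 1) = 2 * ((n + 2) choose 2)"
    by (simp add: choose_two)
  finally show ?thesis by simp
qed

theorem theorem3p13:
  fixes m n s :: nat
  assumes "1 \<le> m" and "m \<le> n + 2" and "int s \<le> s_lower m n"
  shows "T12 m n s"
proof -
  define d where "d = n + 2 - m"
  have s: "s \<le> (m + 1) * d div 2" using s_lower_bound assms(2,3) by (simp add: d_def)
  have "m + 1 - 2 + d = n + 1" using assms(1,2) by (simp add: d_def)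
  then obtain u v b where "indep_config (m + 1) (n + 1) ((m + 1) * d div 2) u v b"
    using indep_config_exists[of "m + 1" d] assms(1) by auto
  then have "indep_config (m + 1) (n + 1) s u v b" using s by (rule indep_config_mono)
  then show ?thesis
    using assms s subabundant by (intro T12_of_indep_config) (auto simp: d_def)
qed

end
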